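(* Let $\varphi_2\colon 2^{S_2}\to\mathbb{R}$ be a folded skew-representable polymatroid function. Then $$\begin{aligned} &\sum_{i=1}^3\bigl(2\varphi_2(A_{i+1}A_{i+2}B_{i+1}B_{i+2}C_i)+\varphi_2(A_iD)+\varphi_2(B_iD)+\varphi_2(C_i)\bigr)\\ &\quad+\varphi_2(C_2)+\varphi_2(A_3B_3C_1)+\varphi_2(A_1A_2B_1B_2)+\varphi_2(C_1C_2C_3)\\ \le\ &2\sum_{i=1}^3\bigl(\varphi_2(A_{i+1}A_{i+2}C_i)+\varphi_2(B_{i+1}B_{i+2}C_i)+\varphi_2(A_iB_iD)\bigr)+\varphi_2(C_1C_2)+4\varphi_2(D) \end{aligned}$$ holds for any subsets $A_1,A_2,A_3,B_1,B_2,B_3,C_1,C_2,C_3,D\subseteq S_2$, where juxtaposition of sets denotes their union and the indices of $A_j,B_j,C_j$ are cyclic modulo $3$ (so $A_4=A_1$, $A_5=A_2$, etc.). Moreover, the inequality is violated if $\varphi_2$ is the rank function of the non-Desargues matroid, $A_i=\{a_i\}$, $B_i=\{b_i\}$, $C_i=\{c_i\}$ for $i\in\{1,2,3\}$, and $D=\{d\}$.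
   Context: Ground sets are finite. A polymatroid function is a set function $\varphi\colon 2^S\to\mathbb{R}$ that is increasing, submodular, and satisfies $\varphi(\emptyset)=0$. An integer-valued polymatroid function $\varphi\colon 2^S\to\mathbb{Z}$ is skew-representable if for some skew field (division ring) $\mathbb{F}$ there is a family $(V_s)_{s\in S}$ of subspaces of a right vector space over $\mathbb{F}$ such that for each $X\subseteq S$, $\varphi(X)$ equals the dimension of the span of $\bigcup_{s\in X}V_s$. A polymatroid function $\varphi$ is folded skew-representable if $k\cdot\varphi$ is skew-representable for some positive integer $k$. The non-Desargues matroid is the simple rank-$3$ matroid on $\{d,a_1,a_2,a_3,b_1,b_2,b_3,c_1,c_2,c_3\}$ whose lines (rank-$2$ flats) with at least three elements are $\{d,a_1,b_1\}$, $\{d,a_2,b_2\}$, $\{d,a_3,b_3\}$, $\{a_1,a_2,c_3\}$, $\{a_1,a_3,c_2\}$, $\{a_2,a_3,c_1\}$, $\{b_1,b_2,c_3\}$, $\{b_1,b_3,c_2\}$, $\{b_2,b_3,c_1\}$. *)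

theory Defs
  imports "HOL-Analysis.Analysis"
begin

section \<open>Right vector spaces over division rings\<close>

text \<open>The library's locale \<^locale>\<open>vector_space\<close> requires a commutative field of scalars, so the
  notions needed here are set up for right vector spaces over a \<^class>\<open>division_ring\<close>.\<close>

locale right_vector_space =
  fixes scale :: "'v::ab_group_add \<Rightarrow> 'f::division_ring \<Rightarrow> 'v" (infixl "\<star>" 75)
  assumes scale_add_left: "(x + y) \<star> a = x \<star> a + y \<star> a"
    and scale_add_right: "x \<star> (a + b) = x \<star> a + x \<star> b"
    and scale_mult: "x \<star> (a * b) = (x \<star> a) \<star> b"
    and scale_one: "x \<star> 1 = x"
begin

definition subspace :: "'v set \<Rightarrow> bool" where
  "subspace U \<longleftrightarrow> 0 \<in> U \<and> (\<forall>x\<in>U. \<forall>y\<in>U. x + y \<in> U) \<and> (\<forall>x\<in>U. \<forall>a. x \<star> a \<in> U)"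

definition span :: "'v set \<Rightarrow> 'v set" where
  "span B = subspace hull B"

definition independent :: "'v set \<Rightarrow> bool" where
  "independent B \<longleftrightarrow>
     (\<forall>T c. finite T \<and> T \<subseteq> B \<and> (\<Sum>v\<in>T. v \<star> c v) = 0 \<longrightarrow> (\<forall>v\<in>T. c v = 0))"

text \<open>A relation rather than a function, so that an infinite-dimensional subspace has no
  dimension instead of a junk value.\<close>

definition has_dim :: "'v set \<Rightarrow> nat \<Rightarrow> bool" where
  "has_dim U n \<longleftrightarrow> (\<exists>B. finite B \<and> card B = n \<and> independent B \<and> span B = U)"

end


section \<open>Polymatroid functions and representability\<close>

definition polymatroid_function :: "'s set \<Rightarrow> ('s set \<Rightarrow> real) \<Rightarrow> bool" where
  "polymatroid_function S \<phi> \<longleftrightarrow>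
     finite S \<and> \<phi> {} = 0 \<and>
     (\<forall>X Y. X \<subseteq> Y \<and> Y \<subseteq> S \<longrightarrow> \<phi> X \<le> \<phi> Y) \<and>
     (\<forall>X Y. X \<subseteq> S \<and> Y \<subseteq> S \<longrightarrow> \<phi> (X \<union> Y) + \<phi> (X \<inter> Y) \<le> \<phi> X + \<phi> Y)"

text \<open>HOL formulas cannot quantify over types. The division ring and the vector space are therefore
  type parameters, passed as \<open>TYPE('f)\<close> and \<open>TYPE('v)\<close>. In a theorem they are free type
  variables, so assuming representability over them amounts to assuming that some skew field
  and some vector space over it exist.\<close>

definition skew_representable ::
  "'f::division_ring itself \<Rightarrow> 'v::ab_group_add itself \<Rightarrow> 's set \<Rightarrow> ('s set \<Rightarrow> real) \<Rightarrow> bool" where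
  "skew_representable F W S \<phi> \<longleftrightarrow>
     polymatroid_function S \<phi> \<and> (\<forall>X\<subseteq>S. \<phi> X \<in> \<int>) \<and>
     (\<exists>(scale :: 'v \<Rightarrow> 'f \<Rightarrow> 'v) (V :: 's \<Rightarrow> 'v set).
        right_vector_space scale \<and>
        (\<forall>s\<in>S. right_vector_space.subspace scale (V s)) \<and>
        (\<forall>X\<subseteq>S. \<exists>n. right_vector_space.has_dim scale
                        (right_vector_space.span scale (\<Union>s\<in>X. V s)) n
                    \<and> \<phi> X = real n))"

definition folded_skew_representable ::
  "'f::division_ring itself \<Rightarrow> 'v::ab_group_add itself \<Rightarrow> 's set \<Rightarrow> ('s set \<Rightarrow> real) \<Rightarrow> bool" where
  "folded_skew_representable F W S \<phi> \<longleftrightarrow>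
     polymatroid_function S \<phi> \<and>
     (\<exists>k::nat. k > 0 \<and> skew_representable F W S (\<lambda>X. real k * \<phi> X))"


section \<open>The two sides of the inequality\<close>

text \<open>Indices live in the three-element type \<open>3\<close> of integers modulo 3, in which \<open>3 = 0\<close>;
  its elements are \<open>1, 2, 3\<close> and \<open>i + 1\<close> is cyclic.\<close>

definition ineq_lhs ::
  "('s set \<Rightarrow> real) \<Rightarrow> (3 \<Rightarrow> 's set) \<Rightarrow> (3 \<Rightarrow> 's set) \<Rightarrow> (3 \<Rightarrow> 's set) \<Rightarrow> 's set \<Rightarrow> real" where
  "ineq_lhs \<phi> A B C D =
     (\<Sum>i\<in>UNIV. 2 * \<phi> (A (i+1) \<union> A (i+2) \<union> B (i+1) \<union> B (i+2) \<union> C i)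
               + \<phi> (A i \<union> D) + \<phi> (B i \<union> D) + \<phi> (C i))
     + \<phi> (C 2) + \<phi> (A 3 \<union> B 3 \<union> C 1) + \<phi> (A 1 \<union> A 2 \<union> B 1 \<union> B 2) + \<phi> (C 1 \<union> C 2 \<union> C 3)"

definition ineq_rhs ::
  "('s set \<Rightarrow> real) \<Rightarrow> (3 \<Rightarrow> 's set) \<Rightarrow> (3 \<Rightarrow> 's set) \<Rightarrow> (3 \<Rightarrow> 's set) \<Rightarrow> 's set \<Rightarrow> real" where
  "ineq_rhs \<phi> A B C D =
     2 * (\<Sum>i\<in>UNIV. \<phi> (A (i+1) \<union> A (i+2) \<union> C i) + \<phi> (B (i+1) \<union> B (i+2) \<union> C i)
                   + \<phi> (A i \<union> B i \<union> D))
     + \<phi> (C 1 \<union> C 2) + 4 * \<phi> D"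


section \<open>The non-Desargues matroid\<close>

definition matroid_rank :: "'e set \<Rightarrow> ('e set \<Rightarrow> nat) \<Rightarrow> bool" where
  "matroid_rank E r \<longleftrightarrow>
     polymatroid_function E (\<lambda>X. real (r X)) \<and> (\<forall>X\<subseteq>E. r X \<le> card X)"

text \<open>Simple: no loops and no parallel elements.\<close>

definition simple_matroid :: "'e set \<Rightarrow> ('e set \<Rightarrow> nat) \<Rightarrow> bool" where
  "simple_matroid E r \<longleftrightarrow>
     matroid_rank E r \<and> (\<forall>x\<in>E. r {x} = 1) \<and> (\<forall>x\<in>E. \<forall>y\<in>E. x \<noteq> y \<longrightarrow> r {x, y} = 2)"

definition flat :: "'e set \<Rightarrow> ('e set \<Rightarrow> nat) \<Rightarrow> 'e set \<Rightarrow> bool" where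
  "flat E r F \<longleftrightarrow> F \<subseteq> E \<and> (\<forall>x\<in>E - F. r (insert x F) > r F)"

definition line :: "'e set \<Rightarrow> ('e set \<Rightarrow> nat) \<Rightarrow> 'e set \<Rightarrow> bool" where
  "line E r F \<longleftrightarrow> flat E r F \<and> r F = 2"

datatype nd_point = pd | pa 3 | pb 3 | pc 3

definition nd_lines :: "nd_point set set" where
  "nd_lines =
     {{pd, pa 1, pb 1}, {pd, pa 2, pb 2}, {pd, pa 3, pb 3},
      {pa 1, pa 2, pc 3}, {pa 1, pa 3, pc 2}, {pa 2, pa 3, pc 1},
      {pb 1, pb 2, pc 3}, {pb 1, pb 3, pc 2}, {pb 2, pb 3, pc 1}}"

definition non_Desargues_rank :: "(nd_point set \<Rightarrow> nat) \<Rightarrow> bool" where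
  "non_Desargues_rank r \<longleftrightarrow>
     simple_matroid UNIV r \<and> r UNIV = 3 \<and> {F. line UNIV r F \<and> card F \<ge> 3} = nd_lines"

text \<open>A rank function with these properties exists, so quantifying over all of them is not
  vacuous.\<close>

lemma UNIV_nd_point: "(UNIV :: nd_point set) =
    {pd, pa 1, pa 2, pa 3, pb 1, pb 2, pb 3, pc 1, pc 2, pc 3}"
proof -
  have "x \<in> {pd, pa 1, pa 2, pa 3, pb 1, pb 2, pb 3, pc 1, pc 2, pc 3}" for x
  proof (cases x)
    case (pa i) then show ?thesis using exhaust_3[of i] by auto
  next
    case (pb i) then show ?thesis using exhaust_3[of i] by auto
  next
    case (pc i) then show ?thesis using exhaust_3[of i] by auto
  qed simp
  then show ?thesis by blast
qed

lemma finite_nd_point: "finite (X :: nd_point set)"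
  by (rule finite_subset[OF subset_UNIV]) (simp add: UNIV_nd_point)

lemma nd_lines_card: "l \<in> nd_lines \<Longrightarrow> card l = 3"
  unfolding nd_lines_def by auto

lemma nd_lines_Int: "\<forall>l\<in>nd_lines. \<forall>m\<in>nd_lines. l = m \<or> card (l \<inter> m) \<le> 1"
  unfolding nd_lines_def by (simp add: Int_insert_left)

lemma nd_lines_meet:
  assumes "l \<in> nd_lines" "m \<in> nd_lines" "x \<noteq> y" "x \<in> l" "y \<in> l" "x \<in> m" "y \<in> m"
  shows "l = m"
proof (rule ccontr)
  assume "l \<noteq> m"
  then have "card (l \<inter> m) \<le> 1" using nd_lines_Int assms(1,2) by blast
  moreover have "card {x, y} \<le> card (l \<inter> m)"
    using assms by (intro card_mono finite_nd_point) auto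
  ultimately show False using assms(3) by simp
qed

lemma card_ge_2_obtain:
  assumes "card X \<ge> 2" obtains x y where "x \<in> X" "y \<in> X" "x \<noteq> y"
proof -
  obtain T where "T \<subseteq> X" "card T = 2" using assms obtain_subset_with_card_n by metis
  then show thesis using that by (auto simp: card_2_iff)
qed

lemma ex_non_Desargues_rank: "\<exists>r. non_Desargues_rank r"
proof -
  define r :: "nd_point set \<Rightarrow> nat" where
    "r X = (if card X \<le> 1 then card X
            else if card X = 2 \<or> (\<exists>l\<in>nd_lines. X \<subseteq> l) then 2 else 3)" for X
  note fin = finite_nd_point
  have le3: "r X \<le> 3" for X by (simp add: r_def)
  have le_card: "r X \<le> card X" for X by (simp add: r_def)
  have ge2: "r X \<ge> 2" if "card X \<ge> 2" for X using that by (simp add: r_def)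
  have small: "r X = card X" if "card X \<le> 2" for X using that by (auto simp: r_def)
  have in_line: "r X \<le> 2" if "X \<subseteq> l" "l \<in> nd_lines" for X l
    using that by (auto simp: r_def)
  have on_line: "\<exists>l\<in>nd_lines. X \<subseteq> l" if "r X \<le> 2" "card X \<ge> 3" for X
    using that by (auto simp: r_def split: if_splits)
  have mono: "r X \<le> r Y" if "X \<subseteq> Y" for X Y
  proof -
    have card: "card X \<le> card Y" using card_mono[OF fin that] .
    consider "card Y \<le> 2" | "r Y \<ge> 3" | "card Y \<ge> 3" "r Y \<le> 2" by linarith
    then show ?thesis
    proof cases
      case 1
      then show ?thesis using card by (simp add: small)
    next
      case 2
      then show ?thesis using le3[of X] by linarith
    next
      case 3
      then obtain l where "l \<in> nd_lines" "Y \<subseteq> l" using on_line by blast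
      then have "r X \<le> 2" using in_line[of X l] that by blast
      then show ?thesis using ge2[of Y] 3 by linarith
    qed
  qed
  have submod: "r (X \<union> Y) + r (X \<inter> Y) \<le> r X + r Y" for X Y
  proof -
    have sub: ?thesis if "X \<subseteq> Y \<or> Y \<subseteq> X"
      using that by (auto simp: Un_absorb1 Un_absorb2 Int_absorb1 Int_absorb2)
    have rank3: ?thesis if "r X \<ge> 3 \<or> r Y \<ge> 3"
      using that le3[of "X \<union> Y"] mono[of "X \<inter> Y" X] mono[of "X \<inter> Y" Y] by auto
    have small_int: ?thesis if "card (X \<inter> Y) \<le> 1" "card X \<ge> 2" "card Y \<ge> 2"
      using that le3[of "X \<union> Y"] le_card[of "X \<inter> Y"] ge2[of X] ge2[of Y] by linarith
    have single: "r (P \<union> Q) + r (P \<inter> Q) \<le> r P + r Q" if P: "card P \<le> 1" and nsub: "\<not> P \<subseteq> Q" for P Q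
    proof -
      have "P \<noteq> {}" using nsub by auto
      then have cP: "card P = 1" using P fin[of P] by (simp add: le_Suc_eq)
      then obtain x where x: "P = {x}" by (auto simp: card_1_singleton_iff)
      then have "x \<notin> Q" using nsub by auto
      then have int: "P \<inter> Q = {}" and cU: "card (P \<union> Q) = Suc (card Q)"
        using x fin[of Q] by auto
      have "r (P \<union> Q) \<le> 1 + r Q"
      proof (cases "card Q \<le> 2")
        case True
        then show ?thesis using le_card[of "P \<union> Q"] cU by (simp add: small)
      next
        case False
        then show ?thesis using le3[of "P \<union> Q"] ge2[of Q] by linarith
      qed
      then show ?thesis using int cP by (simp add: small)
    qed
    show ?thesis
    proof (cases "X \<subseteq> Y \<or> Y \<subseteq> X \<or> r X \<ge> 3 \<or> r Y \<ge> 3 \<or> card X \<le> 1 \<or> card Y \<le> 1 \<or> card (X \<inter> Y) \<le> 1")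
      case True
      consider "X \<subseteq> Y \<or> Y \<subseteq> X" | "r X \<ge> 3 \<or> r Y \<ge> 3" | "card X \<le> 1" "\<not> X \<subseteq> Y"
        | "card Y \<le> 1" "\<not> Y \<subseteq> X" | "card (X \<inter> Y) \<le> 1" "card X \<ge> 2" "card Y \<ge> 2"
        using True le_less_linear[of "card X" 1] le_less_linear[of "card Y" 1]
        by (metis Suc_1 Suc_leI One_nat_def)
      then show ?thesis
      proof cases
        case 3 then show ?thesis using single by blast
      next
        case 4 then show ?thesis using single[of Y X] by (simp add: Un_commute Int_commute)
      qed (use sub rank3 small_int in blast)+
    next
      case False
      then have inc: "\<not> X \<subseteq> Y" "\<not> Y \<subseteq> X" and r2: "r X \<le> 2" "r Y \<le> 2"
        and c2: "card (X \<inter> Y) \<ge> 2"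
        by simp_all
      have "card (X \<inter> Y) < card X" "card (X \<inter> Y) < card Y"
        using inc by (intro psubset_card_mono fin; blast)+
      then have c3: "card X \<ge> 3" "card Y \<ge> 3" using c2 by linarith+
      then obtain l m where l: "l \<in> nd_lines" "X \<subseteq> l" and m: "m \<in> nd_lines" "Y \<subseteq> m"
        using on_line[of X] on_line[of Y] r2 by blast
      obtain x y where "x \<in> X \<inter> Y" "y \<in> X \<inter> Y" "x \<noteq> y"
        using card_ge_2_obtain[OF c2] by blast
      then have "l = m" using nd_lines_meet[of l m x y] l m by blast
      then have "r (X \<union> Y) \<le> 2" "r (X \<inter> Y) \<le> 2"
        using in_line[of "X \<union> Y" l] in_line[of "X \<inter> Y" l] l m by blast+
      then show ?thesis using ge2[of X] ge2[of Y] c3 by linarith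
    qed
  qed
  have poly: "polymatroid_function UNIV (\<lambda>X. real (r X))"
    unfolding polymatroid_function_def
  proof (intro conjI allI impI)
    show "real (r (X \<union> Y)) + real (r (X \<inter> Y)) \<le> real (r X) + real (r Y)" for X Y
      using submod[of X Y] by linarith
  qed (auto simp: fin small mono)
  have "simple_matroid UNIV r"
    using poly le_card by (auto simp: simple_matroid_def matroid_rank_def small)
  moreover have "r UNIV = 3"
  proof -
    have "card (UNIV :: nd_point set) = 10" by (simp add: UNIV_nd_point)
    moreover have "\<not> UNIV \<subseteq> l" if "l \<in> nd_lines" for l
      using nd_lines_card[OF that] card_mono[OF fin, of UNIV l] calculation by auto
    ultimately show ?thesis by (simp add: r_def)
  qed
  moreover have "{F. line UNIV r F \<and> card F \<ge> 3} = nd_lines"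
  proof (intro equalityI subsetI)
    fix F assume "F \<in> {F. line UNIV r F \<and> card F \<ge> 3}"
    then have F: "\<And>x. x \<notin> F \<Longrightarrow> r (insert x F) > 2" "r F = 2" "card F \<ge> 3"
      by (auto simp: line_def flat_def)
    then obtain l where l: "l \<in> nd_lines" "F \<subseteq> l" using on_line[of F] by auto
    have "x \<in> F" if "x \<in> l" for x
      using F(1)[of x] in_line[of "insert x F" l] l that by fastforce
    then show "F \<in> nd_lines" using l by (metis subsetI subset_antisym)
  next
    fix l assume l: "l \<in> nd_lines"
    then have c: "card l = 3" by (rule nd_lines_card)
    have r2: "r l = 2" using in_line[of l l] l ge2[of l] c by simp
    have "r (insert x l) > 2" if x: "x \<notin> l" for x
    proof (rule ccontr)
      assume "\<not> r (insert x l) > 2"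
      moreover have "card (insert x l) \<ge> 3" using c x fin[of l] by simp
      ultimately obtain m where m: "m \<in> nd_lines" "insert x l \<subseteq> m"
        using on_line[of "insert x l"] by auto
      obtain y z where "y \<in> l" "z \<in> l" "y \<noteq> z" using card_ge_2_obtain[of l] c by auto
      then have "l = m" using nd_lines_meet[of l m y z] l m by blast
      then show False using m x by blast
    qed
    then show "l \<in> {F. line UNIV r F \<and> card F \<ge> 3}"
      using r2 c by (simp add: line_def flat_def)
  qed
  ultimately show ?thesis unfolding non_Desargues_rank_def by blast
qed

end

theory Submission
  imports Defs
begin

text \<open>The inequality is a dimension count for Desargues' theorem. Suppose the ten sets are
  subspaces of a vector space. A perspective pair of triangles consists of vectors \<open>x \<in> A\<^sub>1\<close>,
  \<open>y \<in> A\<^sub>2\<close>, \<open>z \<in> A\<^sub>3\<close> and a shift \<open>e \<in> D\<close> such that \<open>x - e \<in> B\<^sub>1\<close>, \<open>y - e \<in> B\<^sub>2\<close>, \<open>z - e \<in> B\<^sub>3\<close>. Since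
  the shift cancels in differences, \<open>x - y\<close> lies both in \<open>A\<^sub>1 + A\<^sub>2\<close> and in \<open>B\<^sub>1 + B\<^sub>2\<close>, and likewise
  for the other two sides. Keep only those quadruples \<open>(e, x, y, z)\<close> for which the three side
  differences moreover lie in \<open>C\<^sub>3\<close>, \<open>C\<^sub>1\<close>, \<open>C\<^sub>2\<close>. The differences add up to zero, so \<open>x - y\<close> lies in
  \<open>C\<^sub>3 \<inter> (C\<^sub>1 + C\<^sub>2)\<close>: this is the collinearity asserted by Desargues' theorem.

  The subspace of the remaining quadruples is large: it arises from \<open>D \<times> A\<^sub>1 \<times> A\<^sub>2 \<times> A\<^sub>3\<close> by six
  linear conditions, and each of them costs at most the codimension of the target subspace in a
  space known to contain all values (\<open>dimension_vimage_ge\<close>). It is also small: by rank-nullity its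
  dimension is at most that of \<open>C\<^sub>3 \<inter> (C\<^sub>1 + C\<^sub>2)\<close> plus that of the kernel of
  \<open>(e, x, y, z) \<mapsto> x - y\<close>, and the kernel is controlled by \<open>A\<^sub>1 \<inter> A\<^sub>2\<close>, \<open>D \<inter> B\<^sub>1\<close> and \<open>A\<^sub>3 \<inter> C\<^sub>1\<close>, the
  degenerate positions of the configuration. Comparing both bounds and rewriting dimensions of
  intersections by the modular law gives \<open>Desargues_dimension_inequality\<close>. The displayed inequality
  is its sum with the three submodularity relations for the lines through \<open>C\<^sub>i\<close>; being homogeneous,
  it descends from \<open>k \<cdot> \<phi>\<close> to \<open>\<phi>\<close>.

  In the non-Desargues matroid all ranks in the inequality are determined by the list of lines,
  the decisive one being that \<open>c\<^sub>1, c\<^sub>2, c\<^sub>3\<close> have rank 3. The two sides evaluate to 43 and 42.\<close>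

section \<open>Dimension over a division ring\<close>

context right_vector_space
begin

lemma scale_zero_left [simp]: "0 \<star> a = 0"
  using scale_add_left[of 0 0 a] by simp

lemma scale_zero_right [simp]: "x \<star> 0 = 0"
  using scale_add_right[of x 0 0] by simp

lemma scale_minus_left: "(- x) \<star> a = - (x \<star> a)"
  using scale_add_left[of x "- x" a] by (simp add: add_eq_0_iff)

lemma scale_minus_one: "x \<star> (- 1) = - x"
  using scale_add_right[of x 1 "- 1"] by (simp add: scale_one add_eq_0_iff)

lemma scale_diff_left: "(x - y) \<star> a = x \<star> a - y \<star> a"
  using scale_add_left[of x "- y" a] by (simp add: scale_minus_left)

lemma scale_sum_left: "(\<Sum>i\<in>I. g i) \<star> a = (\<Sum>i\<in>I. g i \<star> a)"
  by (induction I rule: infinite_finite_induct) (simp_all add: scale_add_left)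

lemma subspace_0: "subspace U \<Longrightarrow> 0 \<in> U"
  and subspace_add: "subspace U \<Longrightarrow> x \<in> U \<Longrightarrow> y \<in> U \<Longrightarrow> x + y \<in> U"
  and subspace_scale: "subspace U \<Longrightarrow> x \<in> U \<Longrightarrow> x \<star> a \<in> U"
  by (auto simp: subspace_def)

lemma subspace_minus: "subspace U \<Longrightarrow> x \<in> U \<Longrightarrow> - x \<in> U"
  using subspace_scale[of U x "- 1"] by (simp add: scale_minus_one)

lemma subspace_diff: "subspace U \<Longrightarrow> x \<in> U \<Longrightarrow> y \<in> U \<Longrightarrow> x - y \<in> U"
  using subspace_add[of U x "- y"] subspace_minus[of U y] by simp

lemma subspace_sum:
  assumes "subspace U" "\<And>i. i \<in> I \<Longrightarrow> g i \<in> U" shows "(\<Sum>i\<in>I. g i) \<in> U"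
  using assms(2)
  by (induction I rule: infinite_finite_induct)
    (simp_all add: subspace_0[OF assms(1)] subspace_add[OF assms(1)])

lemma subspace_Int: "subspace U \<Longrightarrow> subspace W \<Longrightarrow> subspace (U \<inter> W)"
  by (auto simp: subspace_def)

lemma subspace_zero: "subspace {0}"
  by (simp add: subspace_def)

lemma subspace_span: "subspace (span S)"
  unfolding span_def by (rule hull_in) (auto simp: subspace_def)

lemma span_superset: "S \<subseteq> span S"
  unfolding span_def by (rule hull_subset)

lemma span_minimal: "S \<subseteq> U \<Longrightarrow> subspace U \<Longrightarrow> span S \<subseteq> U"
  unfolding span_def by (rule hull_minimal)

lemma span_mono: "S \<subseteq> T \<Longrightarrow> span S \<subseteq> span T"
  unfolding span_def by (rule hull_mono)

lemma span_eq_self: "subspace U \<Longrightarrow> span U = U"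
  unfolding span_def by (rule hull_same)

lemma span_empty: "span {} = {0}"
  using span_minimal[of "{}" "{0}"] subspace_zero subspace_0[OF subspace_span] by blast

lemma span_insertD:
  assumes "x \<in> span (insert a S)" obtains k where "x - a \<star> k \<in> span S"
proof -
  let ?U = "{x. \<exists>k. x - a \<star> k \<in> span S}"
  have "subspace ?U"
    unfolding subspace_def
  proof (intro conjI ballI allI)
    show "0 \<in> ?U" using subspace_0[OF subspace_span] by (auto intro: exI[of _ 0])
  next
    fix x y assume "x \<in> ?U" "y \<in> ?U"
    then obtain k l where "x - a \<star> k \<in> span S" "y - a \<star> l \<in> span S" by auto
    then have "(x - a \<star> k) + (y - a \<star> l) \<in> span S" by (rule subspace_add[OF subspace_span])
    then have "(x + y) - a \<star> (k + l) \<in> span S" by (simp add: scale_add_right algebra_simps)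
    then show "x + y \<in> ?U" by blast
  next
    fix x b assume "x \<in> ?U"
    then obtain k where "x - a \<star> k \<in> span S" by auto
    then have "(x - a \<star> k) \<star> b \<in> span S" by (rule subspace_scale[OF subspace_span])
    then have "x \<star> b - a \<star> (k * b) \<in> span S" by (simp add: scale_mult scale_diff_left)
    then show "x \<star> b \<in> ?U" by blast
  qed
  moreover have "insert a S \<subseteq> ?U"
  proof
    fix x assume "x \<in> insert a S"
    then show "x \<in> ?U"
    proof
      assume "x = a"
      then show ?thesis using subspace_0[OF subspace_span] by (auto simp: scale_one intro!: exI[of _ 1])
    next
      assume "x \<in> S"
      then show ?thesis using span_superset[of S] by (auto intro!: exI[of _ 0])
    qed
  qed
  ultimately have "x \<in> ?U" using span_minimal[of "insert a S" ?U] assms by blast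
  then show thesis using that by blast
qed

lemma span_exchange:
  assumes "x \<in> span (insert a S)" "x \<notin> span S" shows "a \<in> span (insert x S)"
proof -
  obtain k where k: "x - a \<star> k \<in> span S" using span_insertD[OF assms(1)] .
  have "k \<noteq> 0" using k assms(2) by auto
  have "x \<in> span (insert x S)" "x - a \<star> k \<in> span (insert x S)"
    using k span_superset[of "insert x S"] span_mono[of S "insert x S"] by auto
  then have "x - (x - a \<star> k) \<in> span (insert x S)" by (rule subspace_diff[OF subspace_span])
  then have "(x - (x - a \<star> k)) \<star> inverse k \<in> span (insert x S)"
    by (rule subspace_scale[OF subspace_span])
  then show ?thesis using \<open>k \<noteq> 0\<close> by (simp flip: scale_mult add: scale_one)
qed

lemma span_finite_sum:
  assumes "finite S" "x \<in> span S" obtains c where "x = (\<Sum>v\<in>S. v \<star> c v)"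
proof -
  let ?U = "range (\<lambda>c. \<Sum>v\<in>S. v \<star> c v)"
  have "subspace ?U"
    unfolding subspace_def
  proof (intro conjI ballI allI)
    show "0 \<in> ?U" by (auto intro!: image_eqI[of _ _ "\<lambda>_. 0"])
  next
    fix x y assume "x \<in> ?U" "y \<in> ?U"
    then obtain c d where "x = (\<Sum>v\<in>S. v \<star> c v)" "y = (\<Sum>v\<in>S. v \<star> d v)" by auto
    then have "x + y = (\<Sum>v\<in>S. v \<star> (c v + d v))" by (simp add: scale_add_right sum.distrib)
    then show "x + y \<in> ?U" by (auto intro!: image_eqI[of _ _ "\<lambda>v. c v + d v"])
  next
    fix x b assume "x \<in> ?U"
    then obtain c where "x = (\<Sum>v\<in>S. v \<star> c v)" by auto
    then have "x \<star> b = (\<Sum>v\<in>S. v \<star> (c v * b))" by (simp add: scale_sum_left scale_mult)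
    then show "x \<star> b \<in> ?U" by (auto intro!: image_eqI[of _ _ "\<lambda>v. c v * b"])
  qed
  moreover have "S \<subseteq> ?U"
  proof
    fix a assume "a \<in> S"
    have "(\<Sum>v\<in>S. v \<star> (if v = a then 1 else 0)) = (\<Sum>v\<in>S. if v = a then a else 0)"
      by (rule sum.cong) (auto simp: scale_one)
    also have "\<dots> = a" using \<open>a \<in> S\<close> assms(1) by simp
    finally show "a \<in> ?U" by (intro image_eqI[of _ _ "\<lambda>v. if v = a then 1 else 0"]) auto
  qed
  ultimately have "x \<in> ?U" using span_minimal[of S ?U] assms by blast
  then show thesis using that by blast
qed

text \<open>With this characterisation the theory of bases depends only on the closure operator
  \<^term>\<open>span\<close> and its exchange property, and no longer on coefficients.\<close>

lemma independent_iff_notin_span: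
  assumes "finite B"
  shows "independent B \<longleftrightarrow> (\<forall>b\<in>B. b \<notin> span (B - {b}))"
proof
  assume ind: "independent B"
  show "\<forall>b\<in>B. b \<notin> span (B - {b})"
  proof (intro ballI notI)
    fix b assume b: "b \<in> B" "b \<in> span (B - {b})"
    obtain c where c: "b = (\<Sum>v\<in>B - {b}. v \<star> c v)"
      using span_finite_sum[of "B - {b}" b] b(2) assms by auto
    let ?c = "c(b := - 1)"
    have "(\<Sum>v\<in>B. v \<star> ?c v) = b \<star> ?c b + (\<Sum>v\<in>B - {b}. v \<star> ?c v)"
      by (rule sum.remove[OF assms b(1)])
    also have "(\<Sum>v\<in>B - {b}. v \<star> ?c v) = b" by (subst (3) c) (auto intro: sum.cong)
    finally have "(\<Sum>v\<in>B. v \<star> ?c v) = 0" by (simp add: scale_minus_one)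
    then have "?c b = 0" using ind assms b(1) unfolding independent_def by blast
    then show False by simp
  qed
next
  assume nspan: "\<forall>b\<in>B. b \<notin> span (B - {b})"
  show "independent B"
    unfolding independent_def
  proof (intro allI impI ballI, elim conjE, rule ccontr)
    fix T c v assume T: "finite T" "T \<subseteq> B" "(\<Sum>v\<in>T. v \<star> c v) = 0" and v: "v \<in> T" "c v \<noteq> 0"
    have "v \<star> c v + (\<Sum>w\<in>T - {v}. w \<star> c w) = 0"
      using T(3) sum.remove[OF T(1) v(1), of "\<lambda>v. v \<star> c v"] by simp
    then have eq: "v \<star> c v = - (\<Sum>w\<in>T - {v}. w \<star> c w)" by (simp add: eq_neg_iff_add_eq_0)
    have "(\<Sum>w\<in>T - {v}. w \<star> c w) \<in> span (B - {v})"
      using T(2) span_superset[of "B - {v}"]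
      by (intro subspace_sum subspace_scale subspace_span) auto
    then have "(v \<star> c v) \<star> inverse (c v) \<in> span (B - {v})"
      unfolding eq by (intro subspace_scale subspace_minus subspace_span)
    then have "v \<in> span (B - {v})" using v(2) by (simp flip: scale_mult add: scale_one)
    then show False using nspan T(2) v(1) by blast
  qed
qed

lemma independent_subset: "independent B \<Longrightarrow> A \<subseteq> B \<Longrightarrow> independent A"
  unfolding independent_def by blast

lemma independent_empty: "independent {}"
  by (auto simp: independent_def)

lemma independent_insert:
  assumes "finite B" "independent B" "a \<notin> span B" shows "independent (insert a B)"
proof -
  have "a \<notin> B" using assms(3) span_superset by blast
  have "b \<notin> span (insert a B - {b})" if b: "b \<in> insert a B" for b
  proof (cases "b = a")
    case True
    then show ?thesis using assms(3) \<open>a \<notin> B\<close> by simp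
  next
    case False
    then have "b \<in> B" using b by simp
    have "b \<notin> span (B - {b})"
      using assms \<open>b \<in> B\<close> independent_iff_notin_span by blast
    moreover have "insert a B - {b} = insert a (B - {b})" "insert b (B - {b}) = B"
      using False \<open>b \<in> B\<close> by auto
    ultimately show ?thesis using span_exchange[of b a "B - {b}"] assms(3) by auto
  qed
  then show ?thesis using assms(1) by (simp add: independent_iff_notin_span)
qed

text \<open>Vectors of \<open>B\<close> are traded one by one against members of the spanning set \<open>T\<close>.\<close>

lemma Steinitz_exchange:
  assumes "finite B" "independent B" "finite T" "B \<subseteq> span T"
  shows "\<exists>R\<subseteq>T. card R + card B = card T \<and> T \<subseteq> span (B \<union> R)"
  using assms(1,2,4)
proof (induction B rule: finite_induct)
  case empty
  then show ?case using span_superset by auto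
next
  case (insert b B)
  then obtain R where R: "R \<subseteq> T" "card R + card B = card T" "T \<subseteq> span (B \<union> R)"
    using independent_subset[of "insert b B" B] by auto
  have finR: "finite R" using R(1) assms(3) finite_subset by blast
  have bR: "b \<in> span (B \<union> R)"
    using insert.prems(2) span_minimal[OF R(3) subspace_span] by auto
  have bB: "b \<notin> span B"
    using insert.prems(1) insert.hyps independent_iff_notin_span[of "insert b B"] by simp
  \<comment> \<open>A vector \<open>r\<close> can be traded for \<open>b\<close> if it is what makes \<open>b\<close> dependent, so it is looked for
    outside a largest part \<open>R1\<close> of \<open>R\<close> that does not generate \<open>b\<close>.\<close>
  have "\<exists>R1. (R1 \<subseteq> R \<and> b \<notin> span (B \<union> R1)) \<and>
      (\<forall>R2. R2 \<subseteq> R \<and> b \<notin> span (B \<union> R2) \<longrightarrow> card R2 \<le> card R1)"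
    using finR bB
    by (intro ex_has_greatest_nat[of _ "{}" _ "card R + 1"]) (auto simp: less_Suc_eq_le intro: card_mono)
  then obtain R1 where R1: "R1 \<subseteq> R" "b \<notin> span (B \<union> R1)"
    and max: "\<And>R2. R2 \<subseteq> R \<Longrightarrow> b \<notin> span (B \<union> R2) \<Longrightarrow> card R2 \<le> card R1" by blast
  have "R1 \<noteq> R" using R1(2) bR by blast
  then obtain r where r: "r \<in> R" "r \<notin> R1" using R1(1) by blast
  have "card (insert r R1) = Suc (card R1)"
    using r finite_subset[OF R1(1) finR] by simp
  then have "b \<in> span (B \<union> insert r R1)" using max[of "insert r R1"] r R1(1) by fastforce
  then have "r \<in> span (insert b (B \<union> R1))" using span_exchange[of b r "B \<union> R1"] R1(2) by simp
  then have "r \<in> span (insert b B \<union> (R - {r}))"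
    using span_mono[of "insert b (B \<union> R1)" "insert b B \<union> (R - {r})"] R1(1) r by blast
  then have "B \<union> R \<subseteq> span (insert b B \<union> (R - {r}))"
    using span_superset[of "insert b B \<union> (R - {r})"] by blast
  then have "T \<subseteq> span (insert b B \<union> (R - {r}))"
    using R(3) span_minimal[OF _ subspace_span] by blast
  moreover have "card (R - {r}) + card (insert b B) = card T"
    using R(2) card_Suc_Diff1[OF finR r(1)] insert.hyps by simp
  ultimately show ?case using R(1) by blast
qed

lemma independent_card_le:
  "finite B \<Longrightarrow> independent B \<Longrightarrow> finite T \<Longrightarrow> B \<subseteq> span T \<Longrightarrow> card B \<le> card T"
  using Steinitz_exchange[of B T] by force

lemma has_dim_unique: "has_dim U m \<Longrightarrow> has_dim U n \<Longrightarrow> m = n"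
  unfolding has_dim_def by (metis independent_card_le order.antisym span_superset)

definition dimension :: "'v set \<Rightarrow> nat" where
  "dimension U = (THE n. has_dim U n)"

definition finite_dim :: "'v set \<Rightarrow> bool" where
  "finite_dim U \<longleftrightarrow> (\<exists>n. has_dim U n)"

lemma dimension_eq: "has_dim U n \<Longrightarrow> dimension U = n"
  unfolding dimension_def using has_dim_unique by blast

lemma has_dim_basis: "finite B \<Longrightarrow> independent B \<Longrightarrow> span B = U \<Longrightarrow> has_dim U (card B)"
  unfolding has_dim_def by blast

lemma finite_dim_subspace: "finite_dim U \<Longrightarrow> subspace U"
  unfolding finite_dim_def has_dim_def using subspace_span by blast

lemma basis_extension_in_span:
  assumes T: "finite T" "W \<subseteq> span T" and W: "subspace W"
    and I: "finite I" "independent I" "I \<subseteq> W"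
  obtains B where "finite B" "independent B" "I \<subseteq> B" "span B = W"
proof -
  \<comment> \<open>By Steinitz the sizes of independent subsets of \<open>W\<close> are bounded, so a largest one exists.\<close>
  let ?P = "\<lambda>B. finite B \<and> independent B \<and> I \<subseteq> B \<and> B \<subseteq> W"
  have "\<exists>B. ?P B \<and> (\<forall>B'. ?P B' \<longrightarrow> card B' \<le> card B)"
    using I T independent_card_le[OF _ _ T(1)]
    by (intro ex_has_greatest_nat[of ?P I card "card T + 1"]) (auto simp: less_Suc_eq_le)
  then obtain B where B: "?P B" and max: "\<And>B'. ?P B' \<Longrightarrow> card B' \<le> card B" by blast
  have "W \<subseteq> span B"
  proof (rule ccontr)
    assume "\<not> W \<subseteq> span B"
    then obtain w where w: "w \<in> W" "w \<notin> span B" by blast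
    then have "?P (insert w B)" using B independent_insert by auto
    moreover have "w \<notin> B" using w(2) span_superset by blast
    ultimately show False using max[of "insert w B"] B by simp
  qed
  then have "span B = W" using span_minimal[of B W] B W by blast
  then show thesis using that B by blast
qed

lemma finite_dim_span:
  assumes "finite T" shows "finite_dim (span T)"
proof -
  obtain B where "finite B" "independent B" "span B = span T"
    using basis_extension_in_span[OF assms subset_refl subspace_span, of "{}"] independent_empty
    by auto
  then show ?thesis unfolding finite_dim_def using has_dim_basis by blast
qed

lemma finite_dim_obtain_span:
  assumes "finite_dim U" obtains T where "finite T" "span T = U"
  using assms unfolding finite_dim_def has_dim_def by blast

lemma basis_extension:
  assumes "finite_dim U" "subspace W" "W \<subseteq> U" "finite I" "independent I" "I \<subseteq> W"
  obtains B where "finite B" "independent B" "I \<subseteq> B" "span B = W"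
proof -
  obtain T where "finite T" "span T = U" using finite_dim_obtain_span[OF assms(1)] .
  then show thesis using basis_extension_in_span[of T W I] assms that by blast
qed

lemma finite_dim_subset:
  assumes "finite_dim U" "subspace W" "W \<subseteq> U" shows "finite_dim W"
proof -
  obtain B where "finite B" "independent B" "span B = W"
    using basis_extension[OF assms, of "{}"] independent_empty by auto
  then show ?thesis unfolding finite_dim_def using has_dim_basis by blast
qed

lemma dimension_mono:
  assumes "finite_dim U" "subspace W" "W \<subseteq> U" shows "dimension W \<le> dimension U"
proof -
  obtain B where B: "finite B" "independent B" "span B = W"
    using basis_extension[OF assms, of "{}"] independent_empty by auto
  obtain B' where B': "finite B'" "independent B'" "B \<subseteq> B'" "span B' = U"
    using basis_extension[OF assms(1) finite_dim_subspace[OF assms(1)] subset_refl B(1,2)]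
      B(3) span_superset assms(3) by blast
  have "dimension W = card B" "dimension U = card B'"
    using B B' has_dim_basis dimension_eq by blast+
  then show ?thesis using card_mono[OF B'(1,3)] by simp
qed

lemma has_dim_zero: "has_dim {0} 0"
  using has_dim_basis[OF _ independent_empty span_empty] by simp

lemma finite_dim_Int: "finite_dim U \<Longrightarrow> subspace W \<Longrightarrow> finite_dim (U \<inter> W)"
  using finite_dim_subset[of U "U \<inter> W"] subspace_Int finite_dim_subspace by blast

end


section \<open>Linear maps and products\<close>

locale right_linear_map =
  V: right_vector_space s + W: right_vector_space t
  for s :: "'v::ab_group_add \<Rightarrow> 'f::division_ring \<Rightarrow> 'v"
    and t :: "'w::ab_group_add \<Rightarrow> 'f \<Rightarrow> 'w" +
  fixes f :: "'v \<Rightarrow> 'w"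
  assumes map_add: "f (x + y) = f x + f y"
    and map_scale: "f (s x a) = t (f x) a"
begin

lemma map_zero: "f 0 = 0"
  using map_add[of 0 0] by simp

lemma map_diff: "f (x - y) = f x - f y"
  using map_add[of "x - y" y] by simp

lemma subspace_image: "V.subspace U \<Longrightarrow> W.subspace (f ` U)"
  unfolding V.subspace_def W.subspace_def
  by (auto simp flip: map_add map_scale simp: image_iff) (metis map_zero)

lemma subspace_vimage: "V.subspace U \<Longrightarrow> W.subspace X \<Longrightarrow> V.subspace {x \<in> U. f x \<in> X}"
  unfolding V.subspace_def W.subspace_def by (auto simp: map_add map_scale map_zero)

theorem rank_nullity:
  assumes U: "V.finite_dim U"
  shows "W.finite_dim (f ` U)"
    and "W.dimension (f ` U) + V.dimension {x \<in> U. f x = 0} = V.dimension U"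
proof -
  let ?K = "{x \<in> U. f x = 0}"
  have subU: "V.subspace U" using U by (rule V.finite_dim_subspace)
  have subK: "V.subspace ?K" using subspace_vimage[OF subU W.subspace_zero] by simp
  obtain K where K: "finite K" "V.independent K" "V.span K = ?K"
    using V.basis_extension[OF U subK, of "{}"] V.independent_empty by auto
  obtain B where B: "finite B" "V.independent B" "K \<subseteq> B" "V.span B = U"
    using V.basis_extension[OF U subU subset_refl K(1,2)] K(3) V.span_superset by blast
  define E where "E = B - K"
  have finE: "finite E" using B(1) by (simp add: E_def)
  have notin: "f e \<notin> W.span (f ` (E - {e}))" if e: "e \<in> E" for e
  proof
    assume "f e \<in> W.span (f ` (E - {e}))"
    moreover have "W.span (f ` (E - {e})) \<subseteq> f ` V.span (E - {e})"
      by (intro W.span_minimal subspace_image V.subspace_span image_mono V.span_superset)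
    ultimately obtain x where x: "x \<in> V.span (E - {e})" "f e = f x" by blast
    have sub: "V.span (E - {e}) \<subseteq> V.span (B - {e})" "V.span K \<subseteq> V.span (B - {e})"
      using e B(3) by (auto intro!: V.span_mono simp: E_def)
    have "e \<in> U" "x \<in> U"
      using e x(1) V.span_superset[of B] V.span_mono[of "E - {e}" B] B(4) by (auto simp: E_def)
    then have "e - x \<in> ?K" using x(2) V.subspace_diff[OF subU] by (simp add: map_diff)
    then have "e - x \<in> V.span (B - {e})" using K(3) sub by blast
    then have "(e - x) + x \<in> V.span (B - {e})"
      using x(1) sub(1) by (intro V.subspace_add V.subspace_span) auto
    then show False
      using B(1,2) e V.independent_iff_notin_span[of B] by (auto simp: E_def)
  qed
  have inj: "inj_on f E"
  proof (rule inj_onI, rule ccontr)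
    fix e e' assume "e \<in> E" "e' \<in> E" "f e = f e'" "e \<noteq> e'"
    then have "f e \<in> f ` (E - {e})" by auto
    then show False using notin[OF \<open>e \<in> E\<close>] W.span_superset[of "f ` (E - {e})"] by blast
  qed
  have "W.independent (f ` E)"
    unfolding W.independent_iff_notin_span[OF finite_imageI[OF finE]]
  proof
    fix y assume "y \<in> f ` E"
    then obtain e where e: "e \<in> E" "y = f e" by blast
    then have "f ` E - {y} \<subseteq> f ` (E - {e})" by blast
    then show "y \<notin> W.span (f ` E - {y})" using notin[OF e(1)] e(2) W.span_mono[of "f ` E - {y}" "f ` (E - {e})"] by blast
  qed
  moreover have "W.span (f ` E) = f ` U"
  proof
    show "W.span (f ` E) \<subseteq> f ` U"
      using B(4) V.span_superset[of B]
      by (intro W.span_minimal subspace_image subU) (auto simp: E_def)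
    have "B \<subseteq> {x \<in> U. f x \<in> W.span (f ` E)}"
    proof
      fix b assume b: "b \<in> B"
      then have "b \<in> U" using B(4) V.span_superset by blast
      moreover have "f b \<in> W.span (f ` E)"
      proof (cases "b \<in> K")
        case True
        then have "f b = 0" using K(3) V.span_superset by blast
        then show ?thesis using W.subspace_0[OF W.subspace_span] by simp
      next
        case False
        then show ?thesis using b W.span_superset[of "f ` E"] by (auto simp: E_def)
      qed
      ultimately show "b \<in> {x \<in> U. f x \<in> W.span (f ` E)}" by simp
    qed
    then have "V.span B \<subseteq> {x \<in> U. f x \<in> W.span (f ` E)}"
      by (intro V.span_minimal subspace_vimage subU W.subspace_span)
    then show "f ` U \<subseteq> W.span (f ` E)" using B(4) by auto
  qed
  ultimately have dim: "W.has_dim (f ` U) (card (f ` E))"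
    using finE by (intro W.has_dim_basis) auto
  then show "W.finite_dim (f ` U)" unfolding W.finite_dim_def by blast
  have "card (f ` E) = card E" using inj by (rule card_image)
  also have "card E = card B - card K" using B(1,3) K(1) by (simp add: E_def card_Diff_subset)
  finally have "W.dimension (f ` U) = card B - card K" using dim W.dimension_eq by simp
  moreover have "V.dimension ?K = card K" "V.dimension U = card B"
    using K B V.has_dim_basis V.dimension_eq by blast+
  ultimately show "W.dimension (f ` U) + V.dimension ?K = V.dimension U"
    using card_mono[OF B(1,3)] by simp
qed

lemma dimension_inj_image:
  assumes "V.finite_dim U" "\<And>x. x \<in> U \<Longrightarrow> f x = 0 \<Longrightarrow> x = 0"
  shows "W.dimension (f ` U) = V.dimension U"
proof -
  have "{x \<in> U. f x = 0} = {0}"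
    using assms V.subspace_0[OF V.finite_dim_subspace] map_zero by auto
  then show ?thesis
    using rank_nullity(2)[OF assms(1)] V.dimension_eq[OF V.has_dim_zero] by simp
qed

end

definition prod_scale ::
  "('v \<Rightarrow> 'f \<Rightarrow> 'v) \<Rightarrow> ('w \<Rightarrow> 'f \<Rightarrow> 'w) \<Rightarrow> 'v \<times> 'w \<Rightarrow> 'f \<Rightarrow> 'v \<times> 'w" where
  "prod_scale s t p a = (s (fst p) a, t (snd p) a)"

lemma right_vector_space_prod:
  assumes "right_vector_space s" "right_vector_space t"
  shows "right_vector_space (prod_scale s t)"
proof -
  interpret V: right_vector_space s by fact
  interpret W: right_vector_space t by fact
  show ?thesis
    by unfold_locales
      (simp_all add: prod_scale_def V.scale_add_left V.scale_add_right V.scale_mult V.scale_one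
        W.scale_add_left W.scale_add_right W.scale_mult W.scale_one)
qed

lemma finite_dim_Times:
  assumes "right_vector_space s" "right_vector_space t"
    and U: "right_vector_space.finite_dim s U" and X: "right_vector_space.finite_dim t X"
  shows "right_vector_space.finite_dim (prod_scale s t) (U \<times> X)"
    and "right_vector_space.dimension (prod_scale s t) (U \<times> X) =
      right_vector_space.dimension s U + right_vector_space.dimension t X"
proof -
  interpret V: right_vector_space s by fact
  interpret W: right_vector_space t by fact
  interpret P: right_vector_space "prod_scale s t" using assms(1,2) by (rule right_vector_space_prod)
  interpret l: right_linear_map s "prod_scale s t" "\<lambda>x. (x, 0)"
    by unfold_locales (simp_all add: prod_scale_def)
  interpret r: right_linear_map t "prod_scale s t" "\<lambda>x. (0, x)"
    by unfold_locales (simp_all add: prod_scale_def)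
  interpret p: right_linear_map "prod_scale s t" s fst
    by unfold_locales (simp_all add: prod_scale_def)
  obtain B where B: "finite B" "V.span B = U" using V.finite_dim_obtain_span[OF U] .
  obtain C where C: "finite C" "W.span C = X" using W.finite_dim_obtain_span[OF X] .
  let ?T = "(\<lambda>x. (x, 0)) ` B \<union> (\<lambda>x. (0, x)) ` C"
  have subU: "V.subspace U" and subX: "W.subspace X"
    using U X V.finite_dim_subspace W.finite_dim_subspace by blast+
  have subUX: "P.subspace (U \<times> X)"
    using subU subX by (auto simp: V.subspace_def W.subspace_def P.subspace_def prod_scale_def zero_prod_def)
  have left: "(x, 0) \<in> P.span ?T" if "x \<in> U" for x
  proof -
    have "B \<subseteq> {x \<in> U. (x, 0) \<in> P.span ?T}"
      using B(2) V.span_superset[of B] P.span_superset[of ?T] by auto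
    then have "V.span B \<subseteq> {x \<in> U. (x, 0) \<in> P.span ?T}"
      by (intro V.span_minimal l.subspace_vimage subU P.subspace_span)
    then show ?thesis using B(2) that by blast
  qed
  have right: "(0, y) \<in> P.span ?T" if "y \<in> X" for y
  proof -
    have "C \<subseteq> {x \<in> X. (0, x) \<in> P.span ?T}"
      using C(2) W.span_superset[of C] P.span_superset[of ?T] by auto
    then have "W.span C \<subseteq> {x \<in> X. (0, x) \<in> P.span ?T}"
      by (intro W.span_minimal r.subspace_vimage subX P.subspace_span)
    then show ?thesis using C(2) that by blast
  qed
  have "(x, y) \<in> P.span ?T" if "x \<in> U" "y \<in> X" for x y
    using P.subspace_add[OF P.subspace_span left[OF that(1)] right[OF that(2)]] by simp
  then have "U \<times> X \<subseteq> P.span ?T" by auto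
  then show fin: "P.finite_dim (U \<times> X)"
    using P.finite_dim_subset[OF P.finite_dim_span subUX, of ?T] B(1) C(1) by simp
  have "fst ` (U \<times> X) = U" using W.subspace_0[OF W.finite_dim_subspace[OF X]] by force
  moreover have "{x \<in> U \<times> X. fst x = 0} = (\<lambda>x. (0, x)) ` X"
    using V.subspace_0[OF V.finite_dim_subspace[OF U]] by auto
  moreover have "P.dimension ((\<lambda>x. (0, x)) ` X) = W.dimension X"
    by (rule r.dimension_inj_image[OF X]) (simp add: zero_prod_def)
  ultimately show "P.dimension (U \<times> X) = V.dimension U + W.dimension X"
    using p.rank_nullity(2)[OF fin] by simp
qed


section \<open>The modular law\<close>

context right_vector_space
begin

lemma span_Un_eq_sums:
  assumes "subspace U" "subspace W"
  shows "span (U \<union> W) = (\<lambda>(x, y). x + y) ` (U \<times> W)"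
proof
  interpret P: right_vector_space "prod_scale scale scale"
    by (intro right_vector_space_prod right_vector_space_axioms)
  interpret p: right_linear_map "prod_scale scale scale" scale "\<lambda>(x, y). x + y"
    by unfold_locales (auto simp: prod_scale_def scale_add_left algebra_simps)
  have "P.subspace (U \<times> W)"
    using assms by (auto simp: subspace_def P.subspace_def prod_scale_def zero_prod_def)
  moreover have "U \<union> W \<subseteq> (\<lambda>(x, y). x + y) ` (U \<times> W)"
    using subspace_0[OF assms(1)] subspace_0[OF assms(2)] by force
  ultimately show "span (U \<union> W) \<subseteq> (\<lambda>(x, y). x + y) ` (U \<times> W)"
    by (intro span_minimal p.subspace_image)
  show "(\<lambda>(x, y). x + y) ` (U \<times> W) \<subseteq> span (U \<union> W)"
    using span_superset[of "U \<union> W"] by (auto intro!: subspace_add[OF subspace_span])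
qed

text \<open>The modular law is rank-nullity for the addition map on \<open>U \<times> W\<close>, whose image is the sum and
  whose kernel consists of the pairs \<open>(x, - x)\<close> with \<open>x\<close> in the intersection.\<close>

theorem dimension_modular:
  assumes U: "finite_dim U" and W: "finite_dim W"
  shows "finite_dim (span (U \<union> W))"
    and "dimension (span (U \<union> W)) + dimension (U \<inter> W) = dimension U + dimension W"
proof -
  let ?p = "prod_scale scale scale"
  interpret P: right_vector_space ?p
    by (intro right_vector_space_prod right_vector_space_axioms)
  interpret p: right_linear_map ?p scale "\<lambda>(x, y). x + y"
    by unfold_locales (auto simp: prod_scale_def scale_add_left algebra_simps)
  interpret diag: right_linear_map scale ?p "\<lambda>x. (x, - x)"
    by unfold_locales (auto simp: prod_scale_def scale_minus_left)
  have subU: "subspace U" and subW: "subspace W" using U W finite_dim_subspace by blast+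
  note prod = finite_dim_Times[OF right_vector_space_axioms right_vector_space_axioms U W]
  have im: "(\<lambda>(x, y). x + y) ` (U \<times> W) = span (U \<union> W)"
    using span_Un_eq_sums[OF subU subW] by simp
  have "{z \<in> U \<times> W. (case z of (x, y) \<Rightarrow> x + y) = 0} = (\<lambda>x. (x, - x)) ` (U \<inter> W)"
  proof (intro equalityI subsetI)
    fix z assume "z \<in> {z \<in> U \<times> W. (case z of (x, y) \<Rightarrow> x + y) = 0}"
    then obtain x y where z: "z = (x, y)" "x \<in> U" "y \<in> W" "x + y = 0" by auto
    then have "y = - x" "x = - y" by (simp_all add: eq_neg_iff_add_eq_0 add.commute)
    then have "x \<in> W" using subspace_minus[OF subW z(3)] by simp
    then show "z \<in> (\<lambda>x. (x, - x)) ` (U \<inter> W)" using z(1,2) \<open>y = - x\<close> by blast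
  next
    fix z assume "z \<in> (\<lambda>x. (x, - x)) ` (U \<inter> W)"
    then obtain x where "z = (x, - x)" "x \<in> U" "x \<in> W" by blast
    then show "z \<in> {z \<in> U \<times> W. (case z of (x, y) \<Rightarrow> x + y) = 0}"
      using subspace_minus[OF subW] by simp
  qed
  moreover have "P.dimension ((\<lambda>x. (x, - x)) ` (U \<inter> W)) = dimension (U \<inter> W)"
    by (rule diag.dimension_inj_image[OF finite_dim_Int[OF U subW]]) (simp add: zero_prod_def)
  ultimately show "dimension (span (U \<union> W)) + dimension (U \<inter> W) = dimension U + dimension W"
    using p.rank_nullity(2)[OF prod(1)] prod(2) im by simp
  show "finite_dim (span (U \<union> W))" using p.rank_nullity(1)[OF prod(1)] im by simp
qed

lemma span_Un_span_left: "span (span X \<union> Y) = span (X \<union> Y)"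
proof
  have "span X \<subseteq> span (X \<union> Y)" "Y \<subseteq> span (X \<union> Y)"
    using span_mono[of X "X \<union> Y"] span_superset[of "X \<union> Y"] by auto
  then show "span (span X \<union> Y) \<subseteq> span (X \<union> Y)"
    by (intro span_minimal subspace_span) auto
  show "span (X \<union> Y) \<subseteq> span (span X \<union> Y)"
    using span_superset[of X] by (intro span_mono) auto
qed

lemma span_Un_span_right: "span (X \<union> span Y) = span (X \<union> Y)"
  using span_Un_span_left[of Y X] by (simp add: Un_commute)

lemma finite_dim_span_Un:
  "finite_dim (span X) \<Longrightarrow> finite_dim (span Y) \<Longrightarrow> finite_dim (span (X \<union> Y))"
  using dimension_modular(1)[of "span X" "span Y"]
  by (simp add: span_Un_span_left span_Un_span_right)

lemma dimension_submodular:
  assumes "finite_dim (span X)" "finite_dim (span Y)"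
    and "subspace Z" "Z \<subseteq> span X" "Z \<subseteq> span Y"
  shows "dimension (span (X \<union> Y)) + dimension Z \<le> dimension (span X) + dimension (span Y)"
  using dimension_modular(2)[OF assms(1,2)]
    dimension_mono[OF finite_dim_Int[OF assms(1) subspace_span, of Y] assms(3)] assms(4,5)
  by (simp add: span_Un_span_left span_Un_span_right)

end

lemma (in right_linear_map) finite_dim_kernel:
  "V.finite_dim U \<Longrightarrow> V.finite_dim {x \<in> U. f x = 0}"
  using V.finite_dim_subset[of U] subspace_vimage[OF V.finite_dim_subspace W.subspace_zero] by simp

lemma (in right_linear_map) dimension_le_image_kernel:
  assumes "V.finite_dim U" "W.finite_dim T" "\<And>x. x \<in> U \<Longrightarrow> f x \<in> T"
  shows "V.dimension U \<le> W.dimension T + V.dimension {x \<in> U. f x = 0}"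
  using rank_nullity(2)[OF assms(1)] assms(3)
    W.dimension_mono[OF assms(2) subspace_image[OF V.finite_dim_subspace[OF assms(1)]]]
  by fastforce

text \<open>Imposing the linear condition \<open>f x \<in> X\<close> lowers the dimension by at most the codimension of \<open>X\<close>
  in a space \<open>T\<close> that contains all values: the two solution spaces have the same kernel, and the
  images differ by a quotient that embeds into \<open>T / X\<close>.\<close>

lemma (in right_linear_map) dimension_vimage_ge:
  assumes U: "V.finite_dim U" and T: "W.finite_dim T"
    and X: "W.subspace X" "X \<subseteq> T" and im: "\<And>x. x \<in> U \<Longrightarrow> f x \<in> T"
  shows "V.finite_dim {x \<in> U. f x \<in> X}"
    and "V.dimension U + W.dimension X \<le> V.dimension {x \<in> U. f x \<in> X} + W.dimension T"
proof -
  let ?U = "{x \<in> U. f x \<in> X}"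
  have finX: "W.finite_dim X" using W.finite_dim_subset[OF T X] .
  show finU: "V.finite_dim ?U"
    by (rule V.finite_dim_subset[OF U subspace_vimage[OF V.finite_dim_subspace[OF U] X(1)]]) auto
  have eqs: "f ` ?U = f ` U \<inter> X" "{x \<in> ?U. f x = 0} = {x \<in> U. f x = 0}"
    using W.subspace_0[OF X(1)] by auto
  have "W.span (f ` U \<union> X) \<subseteq> T"
    using im X(2) W.finite_dim_subspace[OF T] by (intro W.span_minimal) auto
  then have "W.dimension (W.span (f ` U \<union> X)) \<le> W.dimension T"
    by (intro W.dimension_mono T W.subspace_span)
  then show "V.dimension U + W.dimension X \<le> V.dimension ?U + W.dimension T"
    using rank_nullity(2)[OF U] rank_nullity(2)[OF finU] eqs
      W.dimension_modular(2)[OF rank_nullity(1)[OF U] finX] by simp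
qed


section \<open>The Desargues configuration of subspaces\<close>

context right_vector_space
begin

text \<open>Here each of the terms for the lines through \<open>C\<^sub>i\<close> occurs once. In this form the inequality is
  stronger than the one for polymatroids, which adds the submodularity relations
  \<open>d (A\<^sub>1 \<union> A\<^sub>2 \<union> B\<^sub>1 \<union> B\<^sub>2 \<union> C\<^sub>3) + d C\<^sub>3 \<le> d (A\<^sub>1 \<union> A\<^sub>2 \<union> C\<^sub>3) + d (B\<^sub>1 \<union> B\<^sub>2 \<union> C\<^sub>3)\<close> and their cyclic
  companions.\<close>

lemma Desargues_dimension_inequality:
  fixes A1 A2 A3 B1 B2 B3 C1 C2 C3 D :: "'v set"
  defines "d \<equiv> \<lambda>X. dimension (span X)"
  assumes fin: "finite_dim A1" "finite_dim A2" "finite_dim A3"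
    "finite_dim B1" "finite_dim B2" "finite_dim B3"
    "finite_dim C1" "finite_dim C2" "finite_dim C3" "finite_dim D"
  shows "d (A2 \<union> A3 \<union> B2 \<union> B3 \<union> C1) + d (A3 \<union> A1 \<union> B3 \<union> B1 \<union> C2) + d (A1 \<union> A2 \<union> B1 \<union> B2 \<union> C3)
      + d (A1 \<union> D) + d (A2 \<union> D) + d (A3 \<union> D) + d (B1 \<union> D) + d (B2 \<union> D) + d (B3 \<union> D)
      + d C2 + d (A3 \<union> B3 \<union> C1) + d (A1 \<union> A2 \<union> B1 \<union> B2) + d (C1 \<union> C2 \<union> C3)
    \<le> d (A2 \<union> A3 \<union> C1) + d (A3 \<union> A1 \<union> C2) + d (A1 \<union> A2 \<union> C3)
      + d (B2 \<union> B3 \<union> C1) + d (B3 \<union> B1 \<union> C2) + d (B1 \<union> B2 \<union> C3)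
      + 2 * (d (A1 \<union> B1 \<union> D) + d (A2 \<union> B2 \<union> D) + d (A3 \<union> B3 \<union> D)) + d (C1 \<union> C2) + 4 * d D"
proof -
  note sub = fin[THEN finite_dim_subspace]
  note spans = sub[THEN span_eq_self]
  have finU: "finite_dim (span U)" if "finite_dim U" for U
    using that span_eq_self[OF finite_dim_subspace[OF that]] by simp
  note fin_span = finite_dim_span_Un finU fin

  let ?p2 = "prod_scale scale scale"
  let ?p3 = "prod_scale scale ?p2"
  let ?p4 = "prod_scale scale ?p3"
  note vs = right_vector_space_axioms
  note vs2 = right_vector_space_prod[OF vs vs]
  note vs3 = right_vector_space_prod[OF vs vs2]
  interpret Q: right_vector_space ?p4 by (rule right_vector_space_prod[OF vs vs3])
  interpret a1: right_linear_map ?p4 scale "\<lambda>(e, x, y, z). x"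
    by unfold_locales (auto simp: prod_scale_def)
  interpret last: right_linear_map ?p4 scale "\<lambda>(e, x, y, z). z"
    by unfold_locales (auto simp: prod_scale_def)
  interpret shift: right_linear_map ?p4 scale "\<lambda>(e, x, y, z). e"
    by unfold_locales (auto simp: prod_scale_def)
  interpret b1: right_linear_map ?p4 scale "\<lambda>(e, x, y, z). x - e"
    by unfold_locales (auto simp: prod_scale_def scale_diff_left)
  interpret b2: right_linear_map ?p4 scale "\<lambda>(e, x, y, z). y - e"
    by unfold_locales (auto simp: prod_scale_def scale_diff_left)
  interpret b3: right_linear_map ?p4 scale "\<lambda>(e, x, y, z). z - e"
    by unfold_locales (auto simp: prod_scale_def scale_diff_left)
  interpret c3: right_linear_map ?p4 scale "\<lambda>(e, x, y, z). x - y"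
    by unfold_locales (auto simp: prod_scale_def scale_diff_left)
  interpret c1: right_linear_map ?p4 scale "\<lambda>(e, x, y, z). y - z"
    by unfold_locales (auto simp: prod_scale_def scale_diff_left)
  interpret c2: right_linear_map ?p4 scale "\<lambda>(e, x, y, z). z - x"
    by unfold_locales (auto simp: prod_scale_def scale_diff_left)

  \<comment> \<open>In a quadruple \<open>(e, x, y, z)\<close> the first triangle is \<open>x, y, z\<close> and the second is its translate
    by \<open>- e\<close>. Up to \<open>Y3\<close> the second triangle is placed, from \<open>Y4\<close> on the sides are prescribed.\<close>
  define Y0 where "Y0 = D \<times> A1 \<times> A2 \<times> A3"
  define Y1 where "Y1 = {v \<in> Y0. (case v of (e, x, y, z) \<Rightarrow> x - e) \<in> B1}"
  define Y2 where "Y2 = {v \<in> Y1. (case v of (e, x, y, z) \<Rightarrow> y - e) \<in> B2}"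
  define Y3 where "Y3 = {v \<in> Y2. (case v of (e, x, y, z) \<Rightarrow> z - e) \<in> B3}"
  define Y4 where "Y4 = {v \<in> Y3. (case v of (e, x, y, z) \<Rightarrow> y - z) \<in> C1}"
  define Y5 where "Y5 = {v \<in> Y4. (case v of (e, x, y, z) \<Rightarrow> z - x) \<in> C2}"
  define Y6 where "Y6 = {v \<in> Y5. (case v of (e, x, y, z) \<Rightarrow> x - y) \<in> C3}"
  note Ys = Y0_def Y1_def Y2_def Y3_def Y4_def Y5_def Y6_def
  have Y3: "e \<in> D" "x \<in> A1" "y \<in> A2" "z \<in> A3" "x - e \<in> B1" "y - e \<in> B2" "z - e \<in> B3"
    if "(e, x, y, z) \<in> Y3" for e x y z
    using that by (simp_all add: Ys)
  have Y6: "(e, x, y, z) \<in> Y3" "y - z \<in> C1" "z - x \<in> C2" "x - y \<in> C3"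
    if "(e, x, y, z) \<in> Y6" for e x y z
    using that by (simp_all add: Y4_def Y5_def Y6_def)

  have diff_span: "u - w \<in> span X" if "U \<subseteq> X" "W \<subseteq> X" "u \<in> U" "w \<in> W" for u w U W X
    using that span_superset[of X] by (intro subspace_diff subspace_span) auto
  have sub_span: "U \<subseteq> span X" if "U \<subseteq> X" for U X
    using that span_superset[of X] by blast

  \<comment> \<open>\<open>Pi\<close> contains every possible difference along side \<open>i\<close>, so prescribing it to lie in \<open>Ci\<close>
    costs at most \<open>dim Pi - dim Ci\<close>.\<close>
  define P1 where "P1 = span (A2 \<union> A3 \<union> C1) \<inter> span (B2 \<union> B3 \<union> C1)"
  define P2 where "P2 = span (A3 \<union> A1 \<union> C2) \<inter> span (B3 \<union> B1 \<union> C2)"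
  define P3 where "P3 = span (A1 \<union> A2 \<union> C3) \<inter> span (B1 \<union> B2 \<union> C3)"
  note Ps = P1_def P2_def P3_def
  have finP: "finite_dim P1" "finite_dim P2" "finite_dim P3"
    unfolding Ps by (intro finite_dim_Int fin_span subspace_span)+
  have CP: "C1 \<subseteq> P1" "C2 \<subseteq> P2" "C3 \<subseteq> P3"
    unfolding Ps by (intro Int_greatest sub_span; blast)+
  have dimP1: "dimension P1 + d (A2 \<union> A3 \<union> B2 \<union> B3 \<union> C1) \<le> d (A2 \<union> A3 \<union> C1) + d (B2 \<union> B3 \<union> C1)"
  proof -
    have "A2 \<union> A3 \<union> C1 \<union> (B2 \<union> B3 \<union> C1) = A2 \<union> A3 \<union> B2 \<union> B3 \<union> C1" by blast
    then show ?thesis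
      using dimension_submodular[of "A2 \<union> A3 \<union> C1" "B2 \<union> B3 \<union> C1" P1]
        fin_span finite_dim_subspace[OF finP(1)] by (simp add: P1_def d_def)
  qed
  have dimP2: "dimension P2 + d (A3 \<union> A1 \<union> B3 \<union> B1 \<union> C2) \<le> d (A3 \<union> A1 \<union> C2) + d (B3 \<union> B1 \<union> C2)"
  proof -
    have "A3 \<union> A1 \<union> C2 \<union> (B3 \<union> B1 \<union> C2) = A3 \<union> A1 \<union> B3 \<union> B1 \<union> C2" by blast
    then show ?thesis
      using dimension_submodular[of "A3 \<union> A1 \<union> C2" "B3 \<union> B1 \<union> C2" P2]
        fin_span finite_dim_subspace[OF finP(2)] by (simp add: P2_def d_def)
  qed
  have dimP3: "dimension P3 + d (A1 \<union> A2 \<union> B1 \<union> B2 \<union> C3) \<le> d (A1 \<union> A2 \<union> C3) + d (B1 \<union> B2 \<union> C3)"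
  proof -
    have "A1 \<union> A2 \<union> C3 \<union> (B1 \<union> B2 \<union> C3) = A1 \<union> A2 \<union> B1 \<union> B2 \<union> C3" by blast
    then show ?thesis
      using dimension_submodular[of "A1 \<union> A2 \<union> C3" "B1 \<union> B2 \<union> C3" P3]
        fin_span finite_dim_subspace[OF finP(3)] by (simp add: P3_def d_def)
  qed

  have Y0: "Q.finite_dim Y0"
      "Q.dimension Y0 = dimension D + dimension A1 + dimension A2 + dimension A3"
    unfolding Y0_def
    using finite_dim_Times[OF vs vs3 fin(10) finite_dim_Times(1)[OF vs vs2 fin(1) finite_dim_Times(1)[OF vs vs fin(2,3)]]]
      finite_dim_Times(2)[OF vs vs2 fin(1) finite_dim_Times(1)[OF vs vs fin(2,3)]]
      finite_dim_Times(2)[OF vs vs fin(2,3)] by simp_all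
  have finABD: "finite_dim (span (A1 \<union> B1 \<union> D))" "finite_dim (span (A2 \<union> B2 \<union> D))"
    "finite_dim (span (A3 \<union> B3 \<union> D))"
    by (intro fin_span)+
  have BABD: "B1 \<subseteq> span (A1 \<union> B1 \<union> D)" "B2 \<subseteq> span (A2 \<union> B2 \<union> D)" "B3 \<subseteq> span (A3 \<union> B3 \<union> D)"
    by (intro sub_span; blast)+
  have Y1_in: "(case v of (e, x, y, z) \<Rightarrow> x - e) \<in> span (A1 \<union> B1 \<union> D)" if "v \<in> Y0" for v
    using that by (auto simp: Y0_def intro: diff_span[of A1 _ D])
  have Y1: "Q.finite_dim Y1" "Q.dimension Y0 + dimension B1 \<le> Q.dimension Y1 + d (A1 \<union> B1 \<union> D)"
    unfolding Y1_def d_def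
    by (intro b1.dimension_vimage_ge[OF Y0(1) finABD(1) sub(4) BABD(1)] Y1_in; assumption)+
  have Y2_in: "(case v of (e, x, y, z) \<Rightarrow> y - e) \<in> span (A2 \<union> B2 \<union> D)" if "v \<in> Y1" for v
    using that by (auto simp: Y0_def Y1_def intro: diff_span[of A2 _ D])
  have Y2: "Q.finite_dim Y2" "Q.dimension Y1 + dimension B2 \<le> Q.dimension Y2 + d (A2 \<union> B2 \<union> D)"
    unfolding Y2_def d_def
    by (intro b2.dimension_vimage_ge[OF Y1(1) finABD(2) sub(5) BABD(2)] Y2_in; assumption)+
  have Y3_in: "(case v of (e, x, y, z) \<Rightarrow> z - e) \<in> span (A3 \<union> B3 \<union> D)" if "v \<in> Y2" for v
    using that by (auto simp: Y0_def Y1_def Y2_def intro: diff_span[of A3 _ D])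
  have Y3': "Q.finite_dim Y3" "Q.dimension Y2 + dimension B3 \<le> Q.dimension Y3 + d (A3 \<union> B3 \<union> D)"
    unfolding Y3_def d_def
    by (intro b3.dimension_vimage_ge[OF Y2(1) finABD(3) sub(6) BABD(3)] Y3_in; assumption)+
  have inP: "y - z \<in> P1" "z - x \<in> P2" "x - y \<in> P3" if "(e, x, y, z) \<in> Y3" for e x y z
  proof -
    note m = Y3[OF that]
    \<comment> \<open>The shift \<open>e\<close> cancels, so the differences also lie in the sides of the second triangle.\<close>
    have "(y - e) - (z - e) \<in> span (B2 \<union> B3 \<union> C1)" by (rule diff_span[OF _ _ m(6,7)]) auto
    moreover have "(z - e) - (x - e) \<in> span (B3 \<union> B1 \<union> C2)" by (rule diff_span[OF _ _ m(7,5)]) auto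
    moreover have "(x - e) - (y - e) \<in> span (B1 \<union> B2 \<union> C3)" by (rule diff_span[OF _ _ m(5,6)]) auto
    moreover have "y - z \<in> span (A2 \<union> A3 \<union> C1)" by (rule diff_span[OF _ _ m(3,4)]) auto
    moreover have "z - x \<in> span (A3 \<union> A1 \<union> C2)" by (rule diff_span[OF _ _ m(4,2)]) auto
    moreover have "x - y \<in> span (A1 \<union> A2 \<union> C3)" by (rule diff_span[OF _ _ m(2,3)]) auto
    ultimately show "y - z \<in> P1" "z - x \<in> P2" "x - y \<in> P3" unfolding Ps by simp_all
  qed
  have Y4_in: "(case v of (e, x, y, z) \<Rightarrow> y - z) \<in> P1" if "v \<in> Y3" for v
    using that inP by (auto split: prod.splits)
  have Y4: "Q.finite_dim Y4" "Q.dimension Y3 + dimension C1 \<le> Q.dimension Y4 + dimension P1"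
    unfolding Y4_def
    by (intro c1.dimension_vimage_ge[OF Y3'(1) finP(1) sub(7) CP(1)] Y4_in; assumption)+
  have Y5_in: "(case v of (e, x, y, z) \<Rightarrow> z - x) \<in> P2" if "v \<in> Y4" for v
    using that inP by (auto simp: Y4_def split: prod.splits)
  have Y5: "Q.finite_dim Y5" "Q.dimension Y4 + dimension C2 \<le> Q.dimension Y5 + dimension P2"
    unfolding Y5_def
    by (intro c2.dimension_vimage_ge[OF Y4(1) finP(2) sub(8) CP(2)] Y5_in; assumption)+
  have Y6_in: "(case v of (e, x, y, z) \<Rightarrow> x - y) \<in> P3" if "v \<in> Y5" for v
    using that inP by (auto simp: Y4_def Y5_def split: prod.splits)
  have Y6': "Q.finite_dim Y6" "Q.dimension Y5 + dimension C3 \<le> Q.dimension Y6 + dimension P3"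
    unfolding Y6_def
    by (intro c3.dimension_vimage_ge[OF Y5(1) finP(3) sub(9) CP(3)] Y6_in; assumption)+
  \<comment> \<open>Quadruples in \<open>K\<close> have \<open>x = y\<close>, those in \<open>K1\<close> have \<open>x = y = 0\<close>, and in \<open>K2\<close> only \<open>z\<close> is left.\<close>
  define K where "K = {v \<in> Y6. (case v of (e, x, y, z) \<Rightarrow> x - y) = 0}"
  define K1 where "K1 = {v \<in> K. (case v of (e, x, y, z) \<Rightarrow> x) = 0}"
  define K2 where "K2 = {v \<in> K1. (case v of (e, x, y, z) \<Rightarrow> e) = 0}"
  have K: "Q.finite_dim K"
    unfolding K_def by (rule c3.finite_dim_kernel[OF Y6'(1)])
  have K1: "Q.finite_dim K1"
    unfolding K1_def by (rule a1.finite_dim_kernel[OF K])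
  have K2: "Q.finite_dim K2"
    unfolding K2_def by (rule shift.finite_dim_kernel[OF K1])

  have Y6_le: "Q.dimension Y6 \<le> dimension (C3 \<inter> span (C1 \<union> C2)) + Q.dimension K"
    unfolding K_def
  proof (rule c3.dimension_le_image_kernel[OF Y6'(1) finite_dim_Int[OF fin(9) subspace_span]], clarify)
    fix e x y z assume v: "(e, x, y, z) \<in> Y6"
    \<comment> \<open>Desargues' theorem: the three sides add up to zero.\<close>
    have "- (y - z) - (z - x) \<in> span (C1 \<union> C2)"
      by (rule diff_span[OF _ _ subspace_minus[OF sub(7) Y6(2)[OF v]] Y6(3)[OF v]]) auto
    then show "x - y \<in> C3 \<inter> span (C1 \<union> C2)" using Y6(4)[OF v] by simp
  qed
  have K_le: "Q.dimension K \<le> dimension (A1 \<inter> A2) + Q.dimension K1"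
    unfolding K1_def
  proof (rule a1.dimension_le_image_kernel[OF K finite_dim_Int[OF fin(1) sub(2)]], clarify)
    fix e x y z assume "(e, x, y, z) \<in> K"
    then have "(e, x, x, z) \<in> Y3" using Y6(1) by (auto simp: K_def)
    then show "x \<in> A1 \<inter> A2" using Y3(2,3) by blast
  qed
  have K1_le: "Q.dimension K1 \<le> dimension (D \<inter> B1) + Q.dimension K2"
    unfolding K2_def
  proof (rule shift.dimension_le_image_kernel[OF K1 finite_dim_Int[OF fin(10) sub(4)]], clarify)
    fix e x y z assume "(e, x, y, z) \<in> K1"
    then have "(e, 0, y, z) \<in> Y3" using Y6(1) by (auto simp: K1_def K_def)
    \<comment> \<open>With \<open>x = 0\<close> the second triangle has the vertex \<open>- e\<close> in \<open>B1\<close>.\<close>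
    then have "e \<in> D" "- (0 - e) \<in> B1" using Y3(1,5) subspace_minus[OF sub(4)] by blast+
    then show "e \<in> D \<inter> B1" by simp
  qed
  have K2_le: "Q.dimension K2 + d (A3 \<union> B3 \<union> C1) \<le> d (A3 \<union> B3 \<union> D) + d C1"
  proof -
    have mem: "e = 0 \<and> x = 0 \<and> y = 0 \<and> z \<in> A3 \<inter> C1" if "(e, x, y, z) \<in> K2" for e x y z
    proof -
      have v: "(0, 0, 0, z) \<in> Y6" "e = 0" "x = 0" "y = 0" using that by (auto simp: K2_def K1_def K_def)
      have "z \<in> A3" "- (0 - z) \<in> C1"
        using Y3(4)[OF Y6(1)[OF v(1)]] subspace_minus[OF sub(7) Y6(2)[OF v(1)]] by blast+
      then show ?thesis using v by simp
    qed
    have "Q.dimension K2 = dimension ((\<lambda>(e, x, y, z). z) ` K2)"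
      by (rule last.dimension_inj_image[OF K2, symmetric]) (use mem in \<open>auto simp: zero_prod_def\<close>)
    also have "\<dots> \<le> dimension (A3 \<inter> C1)"
      by (rule dimension_mono[OF finite_dim_Int[OF fin(3) sub(7)]
            last.subspace_image[OF Q.finite_dim_subspace[OF K2]]])
        (use mem in auto)
    finally have "Q.dimension K2 \<le> dimension (A3 \<inter> C1)" .
    moreover have "dimension (span (A3 \<union> B3 \<union> C1)) + dimension (A3 \<inter> C1)
        \<le> dimension (span (A3 \<union> B3)) + dimension (span C1)"
      using span_superset[of "A3 \<union> B3"] span_superset[of C1]
      by (intro dimension_submodular fin_span subspace_Int sub) auto
    moreover have "dimension (span (A3 \<union> B3)) \<le> dimension (span (A3 \<union> B3 \<union> D))"
      by (intro dimension_mono fin_span subspace_span span_mono) auto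
    ultimately show ?thesis unfolding d_def by linarith
  qed
  have A12_meet: "dimension (A1 \<inter> A2) + dimension D = dimension (A1 \<inter> A2 \<inter> D) + d (A1 \<inter> A2 \<union> D)"
    using dimension_modular(2)[OF finite_dim_Int[OF fin(1) sub(2)] fin(10)] by (simp add: d_def)
  have A12_join: "d (A1 \<inter> A2 \<union> D) + d (A1 \<union> A2 \<union> B1 \<union> B2) \<le> d (A1 \<union> B1 \<union> D) + d (A2 \<union> B2 \<union> D)"
  proof -
    have "dimension (span (A1 \<union> B1 \<union> D \<union> (A2 \<union> B2 \<union> D))) + dimension (span (A1 \<inter> A2 \<union> D))
      \<le> dimension (span (A1 \<union> B1 \<union> D)) + dimension (span (A2 \<union> B2 \<union> D))"
      by (intro dimension_submodular fin_span subspace_span span_mono) auto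
    moreover have "dimension (span (A1 \<union> A2 \<union> B1 \<union> B2)) \<le>
        dimension (span (A1 \<union> B1 \<union> D \<union> (A2 \<union> B2 \<union> D)))"
      by (intro dimension_mono fin_span subspace_span span_mono) auto
    ultimately show ?thesis unfolding d_def by linarith
  qed
  have C_meet: "dimension (C3 \<inter> span (C1 \<union> C2)) + d (C1 \<union> C2 \<union> C3) = dimension C3 + d (C1 \<union> C2)"
    using dimension_modular(2)[OF fin(9) finite_dim_span_Un[OF finU finU, OF fin(7,8)]]
    by (simp add: d_def span_Un_span_right Un_commute Un_left_commute)
  have meet: "d (U \<union> D) + dimension (U \<inter> D) = dimension U + dimension D"
    if "finite_dim U" for U
    using dimension_modular(2)[OF that fin(10)] by (simp add: d_def)
  have meet_mono: "dimension (A1 \<inter> A2 \<inter> D) \<le> dimension (A1 \<inter> D)"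
    by (intro dimension_mono finite_dim_Int fin sub subspace_Int) auto
  have dC: "d C1 = dimension C1" "d C2 = dimension C2" "d D = dimension D"
    by (simp_all add: d_def spans)
  have comm: "dimension (D \<inter> B1) = dimension (B1 \<inter> D)" by (simp add: Int_commute)

  have "dimension D + (dimension A1 + dimension A2 + dimension A3)
      + (dimension B1 + dimension B2 + dimension B3) + (dimension C1 + dimension C2 + dimension C3)
    \<le> Q.dimension Y6 + (d (A1 \<union> B1 \<union> D) + d (A2 \<union> B2 \<union> D) + d (A3 \<union> B3 \<union> D))
      + (dimension P1 + dimension P2 + dimension P3)"
    using Y0(2) Y1(2) Y2(2) Y3'(2) Y4(2) Y5(2) Y6'(2) by linarith
  moreover have "Q.dimension Y6 + d (C1 \<union> C2 \<union> C3) + d (A3 \<union> B3 \<union> C1) + d (A1 \<union> A2 \<union> B1 \<union> B2) + dimension D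
    \<le> dimension C3 + d (C1 \<union> C2) + dimension (A1 \<inter> D) + dimension (B1 \<inter> D) + d C1
      + (d (A1 \<union> B1 \<union> D) + d (A2 \<union> B2 \<union> D) + d (A3 \<union> B3 \<union> D))"
    using Y6_le K_le K1_le K2_le A12_meet A12_join C_meet meet_mono comm by linarith
  moreover have "d (A1 \<union> D) + d (A2 \<union> D) + d (A3 \<union> D) + d (B1 \<union> D) + d (B2 \<union> D) + d (B3 \<union> D)
      + (dimension (A1 \<inter> D) + dimension (B1 \<inter> D))
    \<le> (dimension A1 + dimension A2 + dimension A3) + (dimension B1 + dimension B2 + dimension B3)
      + 6 * dimension D"
    using meet[OF fin(1)] meet[OF fin(2)] meet[OF fin(3)] meet[OF fin(4)] meet[OF fin(5)] meet[OF fin(6)]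
    by linarith
  moreover note dC
  moreover have "dimension P1 + dimension P2 + dimension P3
      + (d (A2 \<union> A3 \<union> B2 \<union> B3 \<union> C1) + d (A3 \<union> A1 \<union> B3 \<union> B1 \<union> C2) + d (A1 \<union> A2 \<union> B1 \<union> B2 \<union> C3))
    \<le> d (A2 \<union> A3 \<union> C1) + d (A3 \<union> A1 \<union> C2) + d (A1 \<union> A2 \<union> C3)
      + d (B2 \<union> B3 \<union> C1) + d (B3 \<union> B1 \<union> C2) + d (B1 \<union> B2 \<union> C3)"
    using dimP1 dimP2 dimP3 by linarith
  ultimately show ?thesis by simp
qed

end


section \<open>The inequality for folded skew-representable functions\<close>

lemma cyclic_3:
  "(1::3) + 1 = 2" "(1::3) + 2 = 3" "(2::3) + 1 = 3" "(2::3) + 2 = 1" "(3::3) + 1 = 1" "(3::3) + 2 = 2"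
  by simp_all

lemma ineq_sums_3:
  "ineq_lhs \<phi> A B C D =
    2 * (\<phi> (A 2 \<union> A 3 \<union> B 2 \<union> B 3 \<union> C 1) + \<phi> (A 3 \<union> A 1 \<union> B 3 \<union> B 1 \<union> C 2)
      + \<phi> (A 1 \<union> A 2 \<union> B 1 \<union> B 2 \<union> C 3))
    + \<phi> (A 1 \<union> D) + \<phi> (A 2 \<union> D) + \<phi> (A 3 \<union> D) + \<phi> (B 1 \<union> D) + \<phi> (B 2 \<union> D) + \<phi> (B 3 \<union> D)
    + \<phi> (C 1) + 2 * \<phi> (C 2) + \<phi> (C 3)
    + \<phi> (A 3 \<union> B 3 \<union> C 1) + \<phi> (A 1 \<union> A 2 \<union> B 1 \<union> B 2) + \<phi> (C 1 \<union> C 2 \<union> C 3)"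
  "ineq_rhs \<phi> A B C D =
    2 * (\<phi> (A 2 \<union> A 3 \<union> C 1) + \<phi> (A 3 \<union> A 1 \<union> C 2) + \<phi> (A 1 \<union> A 2 \<union> C 3)
      + \<phi> (B 2 \<union> B 3 \<union> C 1) + \<phi> (B 3 \<union> B 1 \<union> C 2) + \<phi> (B 1 \<union> B 2 \<union> C 3)
      + \<phi> (A 1 \<union> B 1 \<union> D) + \<phi> (A 2 \<union> B 2 \<union> D) + \<phi> (A 3 \<union> B 3 \<union> D))
    + \<phi> (C 1 \<union> C 2) + 4 * \<phi> D"
  unfolding ineq_lhs_def ineq_rhs_def sum_3 cyclic_3 by (simp_all only: algebra_simps)

text \<open>Submodularity with the intersection replaced by any set that it contains.\<close>

lemma polymatroid_submodular:
  assumes "polymatroid_function S \<phi>" "X \<subseteq> S" "Y \<subseteq> S" "Z \<subseteq> X \<inter> Y"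
  shows "\<phi> (X \<union> Y) + \<phi> Z \<le> \<phi> X + \<phi> Y"
proof -
  have "\<phi> Z \<le> \<phi> (X \<inter> Y)" "\<phi> (X \<union> Y) + \<phi> (X \<inter> Y) \<le> \<phi> X + \<phi> Y"
    using assms unfolding polymatroid_function_def by (meson le_infI1)+
  then show ?thesis by linarith
qed

text \<open>For \<open>k \<cdot> \<phi>\<close> represented by subspaces \<open>V s\<close>, every set \<open>X\<close> of elements corresponds to the
  subspace \<open>J X\<close>, and unions correspond to sums.\<close>

theorem folded_skew_representable_inequality:
  assumes rep: "folded_skew_representable TYPE('f::division_ring) TYPE('v::ab_group_add) S \<phi>"
    and S: "\<And>i. A i \<subseteq> S" "\<And>i. B i \<subseteq> S" "\<And>i. C i \<subseteq> S" "D \<subseteq> S"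
  shows "ineq_lhs \<phi> A B C D \<le> ineq_rhs \<phi> A B C D"
proof -
  obtain k :: nat and scale :: "'v \<Rightarrow> 'f \<Rightarrow> 'v" and V where k: "k > 0"
    and poly: "polymatroid_function S \<phi>" and vs: "right_vector_space scale"
    and dim: "\<And>X. X \<subseteq> S \<Longrightarrow> \<exists>n. right_vector_space.has_dim scale
        (right_vector_space.span scale (\<Union>s\<in>X. V s)) n \<and> real k * \<phi> X = real n"
    using rep unfolding folded_skew_representable_def skew_representable_def by blast
  interpret right_vector_space scale by (rule vs)
  define J where "J X = span (\<Union>s\<in>X. V s)" for X
  have fin: "finite_dim (J X)" and rank: "real (dimension (J X)) = real k * \<phi> X" if "X \<subseteq> S" for X
    using dim[OF that] dimension_eq unfolding J_def finite_dim_def by fastforce+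
  have join: "span (J X) = J X" "span (J X \<union> J Y) = J (X \<union> Y)"
      "span (J X \<union> J Y \<union> J Z) = J (X \<union> Y \<union> Z)"
      "span (J X \<union> J Y \<union> J Z \<union> J P) = J (X \<union> Y \<union> Z \<union> P)"
      "span (J X \<union> J Y \<union> J Z \<union> J P \<union> J Q) = J (X \<union> Y \<union> Z \<union> P \<union> Q)" for X Y Z P Q
  proof -
    have 1: "span (J X \<union> U) = span ((\<Union>s\<in>X. V s) \<union> U)" "span (U \<union> J X) = span (U \<union> (\<Union>s\<in>X. V s))"
      for X U by (simp_all add: J_def span_Un_span_left span_Un_span_right)
    have 2: "span (J X \<union> J Y) = J (X \<union> Y)" for X Y
      unfolding 1 by (simp add: J_def UN_Un)
    have 3: "span (U \<union> J Y) = span (span U \<union> J Y)" for U Y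
      by (simp add: span_Un_span_left)
    show "span (J X) = J X" unfolding J_def by (intro span_eq_self subspace_span)
    show "span (J X \<union> J Y) = J (X \<union> Y)" by (rule 2)
    show "span (J X \<union> J Y \<union> J Z) = J (X \<union> Y \<union> Z)"
      by (subst 3) (simp add: 2)
    then show "span (J X \<union> J Y \<union> J Z \<union> J P) = J (X \<union> Y \<union> Z \<union> P)"
      by (subst 3) (simp add: 2)
    then show "span (J X \<union> J Y \<union> J Z \<union> J P \<union> J Q) = J (X \<union> Y \<union> Z \<union> P \<union> Q)"
      by (subst 3) (simp add: 2)
  qed
  note sharp = Desargues_dimension_inequality[OF fin[OF S(1)[of 1]] fin[OF S(1)[of 2]] fin[OF S(1)[of 3]] 
      fin[OF S(2)[of 1]] fin[OF S(2)[of 2]] fin[OF S(2)[of 3]] 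
      fin[OF S(3)[of 1]] fin[OF S(3)[of 2]] fin[OF S(3)[of 3]] fin[OF S(4)],
      unfolded join]
  have "real k * (\<phi> (A 2 \<union> A 3 \<union> B 2 \<union> B 3 \<union> C 1) + \<phi> (A 3 \<union> A 1 \<union> B 3 \<union> B 1 \<union> C 2)
      + \<phi> (A 1 \<union> A 2 \<union> B 1 \<union> B 2 \<union> C 3)
      + \<phi> (A 1 \<union> D) + \<phi> (A 2 \<union> D) + \<phi> (A 3 \<union> D) + \<phi> (B 1 \<union> D) + \<phi> (B 2 \<union> D) + \<phi> (B 3 \<union> D)
      + \<phi> (C 2) + \<phi> (A 3 \<union> B 3 \<union> C 1) + \<phi> (A 1 \<union> A 2 \<union> B 1 \<union> B 2) + \<phi> (C 1 \<union> C 2 \<union> C 3))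
    \<le> real k * (\<phi> (A 2 \<union> A 3 \<union> C 1) + \<phi> (A 3 \<union> A 1 \<union> C 2) + \<phi> (A 1 \<union> A 2 \<union> C 3)
      + \<phi> (B 2 \<union> B 3 \<union> C 1) + \<phi> (B 3 \<union> B 1 \<union> C 2) + \<phi> (B 1 \<union> B 2 \<union> C 3)
      + 2 * (\<phi> (A 1 \<union> B 1 \<union> D) + \<phi> (A 2 \<union> B 2 \<union> D) + \<phi> (A 3 \<union> B 3 \<union> D)) + \<phi> (C 1 \<union> C 2) + 4 * \<phi> D)"
    using sharp[THEN of_nat_mono[where 'a = real]] S by (simp add: rank algebra_simps)
  then have *: "\<phi> (A 2 \<union> A 3 \<union> B 2 \<union> B 3 \<union> C 1) + \<phi> (A 3 \<union> A 1 \<union> B 3 \<union> B 1 \<union> C 2)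
      + \<phi> (A 1 \<union> A 2 \<union> B 1 \<union> B 2 \<union> C 3)
      + \<phi> (A 1 \<union> D) + \<phi> (A 2 \<union> D) + \<phi> (A 3 \<union> D) + \<phi> (B 1 \<union> D) + \<phi> (B 2 \<union> D) + \<phi> (B 3 \<union> D)
      + \<phi> (C 2) + \<phi> (A 3 \<union> B 3 \<union> C 1) + \<phi> (A 1 \<union> A 2 \<union> B 1 \<union> B 2) + \<phi> (C 1 \<union> C 2 \<union> C 3)
    \<le> \<phi> (A 2 \<union> A 3 \<union> C 1) + \<phi> (A 3 \<union> A 1 \<union> C 2) + \<phi> (A 1 \<union> A 2 \<union> C 3)
      + \<phi> (B 2 \<union> B 3 \<union> C 1) + \<phi> (B 3 \<union> B 1 \<union> C 2) + \<phi> (B 1 \<union> B 2 \<union> C 3)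
      + 2 * (\<phi> (A 1 \<union> B 1 \<union> D) + \<phi> (A 2 \<union> B 2 \<union> D) + \<phi> (A 3 \<union> B 3 \<union> D)) + \<phi> (C 1 \<union> C 2) + 4 * \<phi> D"
    using k by (simp only: mult_le_cancel_left_pos of_nat_0_less_iff)
  have meet: "\<phi> (X \<union> Y \<union> Z \<union> P \<union> C i) + \<phi> (C i) \<le> \<phi> (X \<union> Y \<union> C i) + \<phi> (Z \<union> P \<union> C i)"
    if "X \<subseteq> S" "Y \<subseteq> S" "Z \<subseteq> S" "P \<subseteq> S" for X Y Z P i
  proof -
    have "X \<union> Y \<union> C i \<union> (Z \<union> P \<union> C i) = X \<union> Y \<union> Z \<union> P \<union> C i" by blast
    then show ?thesis
      using polymatroid_submodular[OF poly, of "X \<union> Y \<union> C i" "Z \<union> P \<union> C i" "C i"] that S(3)[of i]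
      by simp
  qed
  show ?thesis
    unfolding ineq_sums_3
    using * meet[OF S(1,1,2,2), of 2 3 2 3 1] meet[OF S(1,1,2,2), of 3 1 3 1 2]
      meet[OF S(1,1,2,2), of 1 2 1 2 3]
    by simp
qed


section \<open>Ranks in the non-Desargues matroid\<close>

locale non_Desargues =
  fixes r :: "nd_point set \<Rightarrow> nat"
  assumes non_Desargues: "non_Desargues_rank r"
begin

lemma poly: "polymatroid_function UNIV (\<lambda>X. real (r X))"
  and singleton: "r {x} = 1"
  and pair: "x \<noteq> y \<Longrightarrow> r {x, y} = 2"
  and lines: "{F. line UNIV r F \<and> card F \<ge> 3} = nd_lines"
  and rank_UNIV: "r UNIV = 3"
  using non_Desargues
  by (auto simp: non_Desargues_rank_def simple_matroid_def matroid_rank_def)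

lemma mono: "X \<subseteq> Y \<Longrightarrow> r X \<le> r Y"
  using poly unfolding polymatroid_function_def by simp

lemma rank_line: "l \<in> nd_lines \<Longrightarrow> r l = 2"
  using lines by (auto simp: line_def)

text \<open>Two points of \<open>X\<close> on a line pull the whole line into the closure of \<open>X\<close>, and a further point
  off the line then raises the rank to 3.\<close>

lemma rank_off_line:
  assumes "l \<in> nd_lines" "p \<in> l \<inter> X" "q \<in> l \<inter> X" "p \<noteq> q" "x \<in> X - l"
  shows "r X = 3"
proof -
  have "line UNIV r l" using lines assms(1) by auto
  then have "r (insert x l) > r l" using assms(5) unfolding line_def flat_def by blast
  moreover have "r (insert x l) \<le> r (X \<union> l)" using assms(5) by (intro mono) auto
  ultimately have "r (X \<union> l) \<ge> 3" using rank_line[OF assms(1)] by simp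
  moreover have "r (X \<union> l) + r {p, q} \<le> r X + r l"
    using polymatroid_submodular[OF poly, of X l "{p, q}"] assms(2,3) by simp
  moreover have "r X \<le> 3" using mono[of X UNIV] rank_UNIV by simp
  ultimately show ?thesis using rank_line[OF assms(1)] pair[OF assms(4)] by simp
qed

text \<open>If the three points had rank 2, the line that they span would be one of the listed lines.\<close>

lemma rank_diagonal_points: "r {pc 1, pc 2, pc 3} = 3"
proof (rule ccontr)
  let ?C = "{pc 1, pc 2, pc 3}"
  assume "r ?C \<noteq> 3"
  moreover have "r ?C \<le> 3" using mono[of ?C UNIV] rank_UNIV by simp
  moreover have "2 \<le> r ?C" using mono[of "{pc 1, pc 2}" ?C] pair[of "pc 1" "pc 2"] by simp
  ultimately have "r ?C = 2" by simp
  \<comment> \<open>The spanned line is obtained as a largest set of rank 2 that contains the three points.\<close>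
  define spanned where "spanned G \<longleftrightarrow> ?C \<subseteq> G \<and> r G = 2" for G
  have "\<exists>F. spanned F \<and> (\<forall>G. spanned G \<longrightarrow> card G \<le> card F)"
    using \<open>r ?C = 2\<close> card_mono[OF finite_nd_point subset_UNIV]
    by (intro ex_has_greatest_nat[of _ ?C _ "card (UNIV :: nd_point set) + 1"])
      (simp_all add: spanned_def less_Suc_eq_le)
  then obtain F where "spanned F" and max: "\<And>G. spanned G \<Longrightarrow> card G \<le> card F" by blast
  then have F: "?C \<subseteq> F" "r F = 2" by (simp_all add: spanned_def)
  have "r (insert x F) > r F" if "x \<notin> F" for x
  proof -
    have "\<not> spanned (insert x F)" using max[of "insert x F"] that finite_nd_point[of F] by auto
    then have "r (insert x F) \<noteq> 2" using F(1) unfolding spanned_def by blast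
    then show ?thesis using mono[of F "insert x F"] F(2) by (simp add: subset_insertI)
  qed
  then have "line UNIV r F" using F(2) by (auto simp: line_def flat_def)
  moreover have "card F \<ge> 3" using card_mono[OF finite_nd_point F(1)] by simp
  ultimately have "F \<in> nd_lines" using lines by blast
  then show False using F(1) by (auto simp: nd_lines_def)
qed

theorem inequality_violated:
  "\<not> ineq_lhs (\<lambda>X. real (r X)) (\<lambda>i. {pa i}) (\<lambda>i. {pb i}) (\<lambda>i. {pc i}) {pd}
    \<le> ineq_rhs (\<lambda>X. real (r X)) (\<lambda>i. {pa i}) (\<lambda>i. {pb i}) (\<lambda>i. {pc i}) {pd}"
proof -
  have mem: "{pa 2, pa 3, pc 1} \<in> nd_lines" "{pa 1, pa 3, pc 2} \<in> nd_lines"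
    "{pa 1, pa 2, pc 3} \<in> nd_lines" "{pb 2, pb 3, pc 1} \<in> nd_lines"
    "{pb 1, pb 3, pc 2} \<in> nd_lines" "{pb 1, pb 2, pc 3} \<in> nd_lines"
    "{pd, pa 1, pb 1} \<in> nd_lines" "{pd, pa 2, pb 2} \<in> nd_lines" "{pd, pa 3, pb 3} \<in> nd_lines"
    by (simp_all only: nd_lines_def insert_iff simp_thms)
  have perm: "{pa 3, pa 1, pc 2} = {pa 1, pa 3, pc 2}" "{pb 3, pb 1, pc 2} = {pb 1, pb 3, pc 2}"
    "{pa i, pb i, pd} = {pd, pa i, pb i}" for i
    by blast+
  note on_line = mem[THEN rank_line]
  have "r {pa 2, pa 3, pb 2, pb 3, pc 1} = 3"
    by (rule rank_off_line[OF mem(1), of "pa 2" _ "pa 3" "pb 2"]) simp_all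
  moreover have "r {pa 3, pa 1, pb 3, pb 1, pc 2} = 3"
    by (rule rank_off_line[OF mem(2), of "pa 1" _ "pa 3" "pb 1"]) simp_all
  moreover have "r {pa 1, pa 2, pb 1, pb 2, pc 3} = 3"
    by (rule rank_off_line[OF mem(3), of "pa 1" _ "pa 2" "pb 1"]) simp_all
  moreover have "r {pa 3, pb 3, pc 1} = 3"
    by (rule rank_off_line[OF mem(9), of "pa 3" _ "pb 3" "pc 1"]) simp_all
  moreover have "r {pa 1, pa 2, pb 1, pb 2} = 3"
    by (rule rank_off_line[OF mem(3), of "pa 1" _ "pa 2" "pb 1"]) simp_all
  ultimately show ?thesis
    unfolding ineq_sums_3 Un_insert_left Un_empty_left
    using rank_diagonal_points on_line by (simp add: perm pair singleton)
qed

end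


theorem corollary7p13:
  shows
    "(\<forall>(S\<^sub>2 :: 's set) \<phi>\<^sub>2.
        folded_skew_representable TYPE('f::division_ring) TYPE('v::ab_group_add) S\<^sub>2 \<phi>\<^sub>2 \<longrightarrow>
        (\<forall>A B C D. (\<forall>i. A i \<subseteq> S\<^sub>2) \<and> (\<forall>i. B i \<subseteq> S\<^sub>2) \<and> (\<forall>i. C i \<subseteq> S\<^sub>2) \<and> D \<subseteq> S\<^sub>2 \<longrightarrow>
           ineq_lhs \<phi>\<^sub>2 A B C D \<le> ineq_rhs \<phi>\<^sub>2 A B C D))
     \<and> (\<forall>r. non_Desargues_rank r \<longrightarrow>
          \<not> ineq_lhs (\<lambda>X. real (r X)) (\<lambda>i. {pa i}) (\<lambda>i. {pb i}) (\<lambda>i. {pc i}) {pd}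
            \<le> ineq_rhs (\<lambda>X. real (r X)) (\<lambda>i. {pa i}) (\<lambda>i. {pb i}) (\<lambda>i. {pc i}) {pd})"
proof (intro conjI allI impI)
  fix S\<^sub>2 :: "'s set" and \<phi>\<^sub>2 and A B C :: "3 \<Rightarrow> 's set" and D
  assume rep: "folded_skew_representable TYPE('f) TYPE('v) S\<^sub>2 \<phi>\<^sub>2"
    and sub: "(\<forall>i. A i \<subseteq> S\<^sub>2) \<and> (\<forall>i. B i \<subseteq> S\<^sub>2) \<and> (\<forall>i. C i \<subseteq> S\<^sub>2) \<and> D \<subseteq> S\<^sub>2"
  have "A i \<subseteq> S\<^sub>2" "B i \<subseteq> S\<^sub>2" "C i \<subseteq> S\<^sub>2" "D \<subseteq> S\<^sub>2" for i using sub by simp_all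
  then show "ineq_lhs \<phi>\<^sub>2 A B C D \<le> ineq_rhs \<phi>\<^sub>2 A B C D"
    by (rule folded_skew_representable_inequality[OF rep])
next
  fix r
  assume "non_Desargues_rank r"
  then interpret non_Desargues r by unfold_locales
  show "\<not> ineq_lhs (\<lambda>X. real (r X)) (\<lambda>i. {pa i}) (\<lambda>i. {pb i}) (\<lambda>i. {pc i}) {pd}
      \<le> ineq_rhs (\<lambda>X. real (r X)) (\<lambda>i. {pa i}) (\<lambda>i. {pb i}) (\<lambda>i. {pc i}) {pd}"
    by (rule inequality_violated)
qed

end
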